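(* Let $I$ be a non-empty set and $\langle \alpha_i : i\in I\rangle$ a sequence of non-zero ordinals. For each $i\in I$ write $\alpha_i=\gamma_i+n_i$, where $\gamma_i$ is a limit ordinal or $0$ and $n_i\in\omega$. For an ordinal $\alpha$ let $I_\alpha=\{i\in I:\alpha_i=\alpha\}$, and for $\gamma$ a limit ordinal or $0$ let $J_\gamma=\{i\in I:\gamma_i=\gamma\}$. Then the poset $\bigcup_{i\in I}\alpha_i$ is reversible if and only if exactly one of the following holds: (I) $\langle \alpha_i:i\in I\rangle$ is a finite-to-one sequence; (II) the maximum $\gamma=\max\{\gamma_i:i\in I\}$ exists, $|I_\alpha|<\omega$ for every ordinal $\alpha\le\gamma$, and the sequence $\langle n_i: i\in J_\gamma\setminus I_\gamma\rangle$ is a reversible sequence of natural numbers which is not finite-to-one. The same equivalence holds for the poset $\bigcup_{i\in I}\alpha_i^*$ (disjoint union of the reversed orders).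
   Context: A poset $\mathbb{P}$ is reversible iff every bijective homomorphism (order-preserving bijection) $f:\mathbb{P}\to\mathbb{P}$ is an automorphism. The poset $\bigcup_{i\in I}\alpha_i$ denotes the disjoint union of pairwise disjoint well orders $\mathbb{L}_i\cong\alpha_i$, where elements from different components are incomparable; $\alpha^*$ denotes the reverse of the order $\alpha$. A sequence $\langle x_i:i\in I\rangle$ is finite-to-one iff there is no infinite $J\subseteq I$ on which it is constant. Let $\mathrm{Sur}(I)$ and $\mathrm{Sym}(I)$ denote the sets of surjections and bijections $I\to I$. A sequence $\langle n_i:i\in I\rangle$ of positive integers is a reversible sequence of natural numbers iff there is no $f\in\mathrm{Sur}(I)\setminus\mathrm{Sym}(I)$ such that $\sum_{i\in f^{-1}[\{j\}]}n_i=n_j$ for all $j\in I$. *)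

theory Defs
  imports Main
begin

unbundle cardinal_syntax

text \<open>
  Ordinals are represented, as in \<^theory>\<open>HOL.BNF_Wellorder_Constructions\<close>, by (reflexive)
  well orders \<open>r :: 'a rel\<close> satisfying \<^const>\<open>Well_order\<close>. Equality of ordinals is order isomorphism
  \<open>r =o s\<close>, their comparison is \<open>r \<le>o s\<close>, and the ordinal 0 is the empty relation.
  A poset is a reflexive relation \<open>R\<close> with carrier \<open>Field R\<close>.
\<close>

text \<open>
  The homomorphism property is \<^const>\<open>compat\<close>; \<^const>\<open>iso\<close> is isomorphism for arbitrary relations,
  not only for well orders, by \<open>iso_iff2\<close>.
\<close>

definition reversible :: "'a rel \<Rightarrow> bool" where
  "reversible P \<longleftrightarrow>
     (\<forall>f. bij_betw f (Field P) (Field P) \<and> compat P P f \<longrightarrow> iso P P f)"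

definition disjoint_union :: "'i set \<Rightarrow> ('i \<Rightarrow> 'a rel) \<Rightarrow> ('i \<times> 'a) rel" where
  "disjoint_union I r = {((i, x), (i, y)) | i x y. i \<in> I \<and> (x, y) \<in> r i}"

lemma Field_disjoint_union: "Field (disjoint_union I r) = (SIGMA i:I. Field (r i))"
  by (fastforce simp: disjoint_union_def Field_def)

lemma Partial_order_disjoint_union:
  assumes "\<And>i. i \<in> I \<Longrightarrow> Partial_order (r i)"
  shows "Partial_order (disjoint_union I r)"
proof -
  have R: "refl_on (Field (r i)) (r i)" "trans (r i)" "antisym (r i)" if "i \<in> I" for i
    using assms[OF that] by (auto simp: order_on_defs)
  have "refl_on (Field (disjoint_union I r)) (disjoint_union I r)"
    unfolding Field_disjoint_union using R(1)
    by (auto simp: refl_on_def disjoint_union_def)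
  moreover have "trans (disjoint_union I r)"
    using R(2) unfolding trans_def disjoint_union_def by blast
  moreover have "antisym (disjoint_union I r)"
    using R(3) by (auto simp: antisym_def disjoint_union_def)
  ultimately show ?thesis
    by (auto simp: order_on_defs intro: FieldI1 FieldI2)
qed

text \<open>The ordinal sum: a copy of \<open>r\<close> followed by a copy of \<open>s\<close>.\<close>

definition ordinal_sum :: "'a rel \<Rightarrow> 'b rel \<Rightarrow> ('a + 'b) rel" where
  "ordinal_sum r s =
     {(Inl x, Inl y) | x y. (x, y) \<in> r} \<union>
     {(Inr x, Inr y) | x y. (x, y) \<in> s} \<union>
     {(Inl x, Inr y) | x y. x \<in> Field r \<and> y \<in> Field s}"

definition limit_ordinal :: "'a rel \<Rightarrow> bool" where
  "limit_ordinal r \<longleftrightarrow>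
     Well_order r \<and> r \<noteq> {} \<and> \<not> (\<exists>m \<in> Field r. \<forall>x \<in> Field r. (x, m) \<in> r)"

text \<open>The parameter \<open>eq\<close> is the equality of terms: \<open>(=o)\<close> for ordinals, \<open>(=)\<close> for numbers.\<close>

definition finite_to_one :: "('b \<Rightarrow> 'b \<Rightarrow> bool) \<Rightarrow> 'i set \<Rightarrow> ('i \<Rightarrow> 'b) \<Rightarrow> bool" where
  "finite_to_one eq I x \<longleftrightarrow>
     \<not> (\<exists>J \<subseteq> I. infinite J \<and> (\<forall>i \<in> J. \<forall>j \<in> J. eq (x i) (x j)))"

text \<open>
  The sum over an infinite fibre diverges, hence differs from every \<open>n j\<close>; since \<open>sum\<close> is 0 on
  infinite sets, finiteness of the fibres is stated explicitly. Functions are only considered on \<open>I\<close>.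
\<close>

definition reversible_nat_seq :: "'i set \<Rightarrow> ('i \<Rightarrow> nat) \<Rightarrow> bool" where
  "reversible_nat_seq I n \<longleftrightarrow>
     (\<forall>i \<in> I. n i > 0) \<and>
     \<not> (\<exists>f. f ` I = I \<and> \<not> inj_on f I \<and>
            (\<forall>j \<in> I. finite {i \<in> I. f i = j} \<and> (\<Sum>i \<in> {i \<in> I. f i = j}. n i) = n j))"

text \<open>
  The set of indices at which a sequence of ordinals takes the value \<open>a\<close>: this is \<open>I\<^sub>a\<close> for the
  sequence of the \<open>\<alpha> i\<close> and \<open>J\<^sub>a\<close> for the sequence of their limit parts \<open>\<gamma> i\<close>.
\<close>

definition ordinal_fibre :: "'i set \<Rightarrow> ('i \<Rightarrow> 'a rel) \<Rightarrow> 'a rel \<Rightarrow> 'i set" where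
  "ordinal_fibre I x a = {i \<in> I. x i =o a}"

text \<open>
  The maximum is \<open>\<gamma> m\<close>. Every ordinal below it is isomorphic to an initial segment of \<open>\<gamma> m\<close>, so
  it suffices that \<open>a\<close> ranges over the well orders on the same type.
\<close>

definition max_condition ::
    "'i set \<Rightarrow> ('i \<Rightarrow> 'a rel) \<Rightarrow> ('i \<Rightarrow> 'a rel) \<Rightarrow> ('i \<Rightarrow> nat) \<Rightarrow> bool" where
  "max_condition I \<alpha> \<gamma> n \<longleftrightarrow>
     (\<exists>m \<in> I. (\<forall>i \<in> I. \<gamma> i \<le>o \<gamma> m) \<and>
        (\<forall>a :: 'a rel. Well_order a \<and> a \<le>o \<gamma> m \<longrightarrow> finite (ordinal_fibre I \<alpha> a)) \<and>
        reversible_nat_seq (ordinal_fibre I \<gamma> (\<gamma> m) - ordinal_fibre I \<alpha> (\<gamma> m)) n \<and>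
        \<not> finite_to_one (=) (ordinal_fibre I \<gamma> (\<gamma> m) - ordinal_fibre I \<alpha> (\<gamma> m)) n)"

end

theory Submission
  imports Defs
begin

text \<open>
  A bijective endomorphism of a disjoint union of well orders maps every component into a component.
  It induces a surjection \<open>\<phi>\<close> of the index set such that the component \<open>j\<close> is partitioned into copies
  of the components in \<open>\<phi>\<close>'s fibre over \<open>j\<close>, and it is an automorphism iff \<open>\<phi>\<close> is injective.
  So \<open>\<alpha> i \<le> \<alpha> (\<phi> i)\<close>, and by well-founded induction \<open>\<phi>\<close> permutes every class \<open>I\<^sub>a\<close> on or
  below which all classes are finite. If (II) holds, this leaves the ordinals \<open>\<gamma> + n\<close> with \<open>n > 0\<close>;
  a partition of \<open>\<gamma> + n\<close> into copies of \<open>\<gamma> + n i\<close> forces \<open>n = \<Sum>n i\<close>, and reversibility of the sequence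
  of numbers applies.

  Conversely, a limit ordinal is the disjoint union of finitely many copies of itself, so
  \<open>\<gamma> + n\<close> absorbs any ordinal \<open>a \<le> \<gamma>\<close>; if \<open>I\<^sub>a\<close> is infinite, one member of it can be spared. If no
  such absorption is possible but some \<open>I\<^sub>a\<close> is infinite, then the maximum \<open>\<gamma>\<close> exists, and a
  witness against reversibility of the numbers \<open>n i\<close> lifts to the ordinals \<open>\<gamma> + n i\<close>.
\<close>

section \<open>Condensations\<close>

text \<open>Reversibility concerns one poset; two posets on different types are allowed here so that
  a map can be treated one component at a time.\<close>

definition condenses :: "'a rel \<Rightarrow> 'b rel \<Rightarrow> bool" where
  "condenses P Q \<longleftrightarrow> (\<exists>f. bij_betw f (Field P) (Field Q) \<and> compat P Q f)"

lemma compatD: "compat r s f \<Longrightarrow> (x, y) \<in> r \<Longrightarrow> (f x, f y) \<in> s"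
  by (simp add: compat_def)

lemma condenses_trans:
  assumes "condenses P Q" "condenses Q R"
  shows "condenses P R"
proof -
  obtain f g where f: "bij_betw f (Field P) (Field Q)" "compat P Q f"
    and g: "bij_betw g (Field Q) (Field R)" "compat Q R g"
    using assms by (auto simp: condenses_def)
  have "bij_betw (g \<circ> f) (Field P) (Field R)" "compat P R (g \<circ> f)"
    using f g bij_betw_trans by (auto simp: compat_def)
  then show ?thesis unfolding condenses_def by blast
qed

lemma ordIso_condenses:
  assumes "r =o s" shows "condenses r s"
proof -
  obtain f where "iso r s f" using assms by (auto simp: ordIso_def)
  then have "bij_betw f (Field r) (Field s)" "compat r s f"
    unfolding iso_iff2 compat_def by (blast intro: FieldI1 FieldI2)+
  then show ?thesis unfolding condenses_def by blast
qed

lemma disjoint_union_iff: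
  "((i, x), (j, y)) \<in> disjoint_union I r \<longleftrightarrow> i = j \<and> i \<in> I \<and> (x, y) \<in> r i"
  by (auto simp: disjoint_union_def)

text \<open>The maps of the fibres are glued, each value being tagged with its component. The clause
  on \<open>fst\<close> lets the injectivity of \<open>\<phi>\<close> be tested on
  \<open>f\<close>.\<close>

lemma condenses_fibrewise:
  assumes "\<And>j. j \<in> J \<Longrightarrow> condenses (disjoint_union {i \<in> I. \<phi> i = j} r) (s j)"
    and "\<phi> ` I \<subseteq> J"
  obtains f where "bij_betw f (Field (disjoint_union I r)) (Field (disjoint_union J s))"
    and "compat (disjoint_union I r) (disjoint_union J s) f"
    and "\<And>i x. fst (f (i, x)) = \<phi> i"
proof -
  have "\<forall>j\<in>J. \<exists>g. bij_betw g (SIGMA i:{i \<in> I. \<phi> i = j}. Field (r i)) (Field (s j)) \<and>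
          compat (disjoint_union {i \<in> I. \<phi> i = j} r) (s j) g"
    using assms(1) by (auto simp: condenses_def Field_disjoint_union)
  from bchoice[OF this] obtain g where
    bij: "\<And>j. j \<in> J \<Longrightarrow> bij_betw (g j) (SIGMA i:{i \<in> I. \<phi> i = j}. Field (r i)) (Field (s j))"
    and comp: "\<And>j. j \<in> J \<Longrightarrow> compat (disjoint_union {i \<in> I. \<phi> i = j} r) (s j) (g j)"
    by auto
  define f where "f = (\<lambda>(i, x). (\<phi> i, g (\<phi> i) (i, x)))"
  have "inj_on f (SIGMA i:I. Field (r i))"
  proof (rule inj_onI, clarify)
    fix i x k y
    assume *: "i \<in> I" "x \<in> Field (r i)" "k \<in> I" "y \<in> Field (r k)" "f (i, x) = f (k, y)"
    then have "g (\<phi> i) (i, x) = g (\<phi> i) (k, y)" "\<phi> k = \<phi> i" "\<phi> i \<in> J"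
      using assms(2) by (auto simp: f_def)
    moreover have "inj_on (g (\<phi> i)) (SIGMA l:{l \<in> I. \<phi> l = \<phi> i}. Field (r l))"
      using bij \<open>\<phi> i \<in> J\<close> by (blast intro: bij_betw_imp_inj_on)
    ultimately have "(i, x) = (k, y)" using * by (intro inj_onD[of "g (\<phi> i)"]) auto
    then show "i = k \<and> x = y" by simp
  qed
  moreover have "f ` (SIGMA i:I. Field (r i)) = (SIGMA j:J. Field (s j))"
  proof (intro equalityI subsetI)
    fix p assume "p \<in> f ` (SIGMA i:I. Field (r i))"
    then obtain i x where "i \<in> I" "x \<in> Field (r i)" "p = f (i, x)" by auto
    then show "p \<in> (SIGMA j:J. Field (s j))"
      using assms(2) bij_betwE[OF bij[of "\<phi> i"]] by (auto simp: f_def)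
  next
    fix p assume "p \<in> (SIGMA j:J. Field (s j))"
    then obtain j y where p: "p = (j, y)" "j \<in> J" "y \<in> Field (s j)" by auto
    moreover then have "y \<in> g j ` (SIGMA l:{l \<in> I. \<phi> l = j}. Field (r l))"
      using bij_betw_imp_surj_on[OF bij] by blast
    ultimately obtain i x where "i \<in> I" "\<phi> i = j" "x \<in> Field (r i)" "g j (i, x) = y"
      by auto
    then show "p \<in> f ` (SIGMA i:I. Field (r i))"
      using p by (intro image_eqI[of _ _ "(i, x)"]) (auto simp: f_def)
  qed
  moreover have "compat (disjoint_union I r) (disjoint_union J s) f"
    unfolding compat_def
  proof clarify
    fix i x k y assume "((i, x), (k, y)) \<in> disjoint_union I r"
    then have *: "i = k" "i \<in> I" "(x, y) \<in> r i" by (auto simp: disjoint_union_iff)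
    then have "((i, x), (k, y)) \<in> disjoint_union {l \<in> I. \<phi> l = \<phi> i} r" "\<phi> i \<in> J"
      using assms(2) by (auto simp: disjoint_union_iff)
    then show "(f (i, x), f (k, y)) \<in> disjoint_union J s"
      using compatD[OF comp] * by (simp add: f_def disjoint_union_iff)
  qed
  ultimately show ?thesis
    using that[of f] by (auto simp: bij_betw_def Field_disjoint_union f_def)
qed

lemma condenses_singleton:
  assumes "condenses (r i) s" shows "condenses (disjoint_union {i} r) s"
proof -
  obtain f where f: "bij_betw f (Field (r i)) (Field s)" "compat (r i) s f"
    using assms by (auto simp: condenses_def)
  have "bij_betw (f \<circ> snd) (SIGMA k:{i}. Field (r k)) (Field s)"
    by (rule bij_betw_trans[OF _ f(1)]) (auto simp: bij_betw_def inj_on_def image_iff)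
  moreover have "compat (disjoint_union {i} r) s (f \<circ> snd)"
    using f(2) by (auto simp: compat_def disjoint_union_iff)
  ultimately show ?thesis unfolding condenses_def Field_disjoint_union by blast
qed

lemma condenses_disjoint_union:
  assumes "\<And>i. i \<in> I \<Longrightarrow> condenses (r i) (s i)"
  shows "condenses (disjoint_union I r) (disjoint_union I s)"
proof -
  have "condenses (disjoint_union {k \<in> I. k = i} r) (s i)" if "i \<in> I" for i
  proof -
    have "{k \<in> I. k = i} = {i}" using that by auto
    then show ?thesis using condenses_singleton assms that by metis
  qed
  from condenses_fibrewise[of I I "\<lambda>i. i" r s, OF this] show ?thesis
    unfolding condenses_def by (metis image_ident order_refl)
qed

section \<open>Reversibility in terms of maps of the index set\<close>

lemma Field_nonempty: "r \<noteq> {} \<Longrightarrow> \<exists>x. x \<in> Field r"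
  by (auto simp: Field_def)

text \<open>These are the index maps induced by bijective endomorphisms of the disjoint union; of
  the endomorphism only the existence of its part over each index is kept.\<close>

abbreviation condensing :: "'i set \<Rightarrow> ('i \<Rightarrow> 'a rel) \<Rightarrow> ('i \<Rightarrow> 'i) \<Rightarrow> bool" where
  "condensing I r \<phi> \<equiv>
     \<phi> ` I = I \<and> (\<forall>j\<in>I. condenses (disjoint_union {i \<in> I. \<phi> i = j} r) (r j))"

text \<open>Comparable elements have comparable images, so totality holds each component together.
  If two components are merged, incomparable elements get comparable images; if none are, totality
  and injectivity reflect the order inside a component.\<close>

lemma reversible_disjoint_union_iff:
  assumes lin: "\<And>i. i \<in> I \<Longrightarrow> Linear_order (r i)" and ne: "\<And>i. i \<in> I \<Longrightarrow> r i \<noteq> {}"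
  shows "reversible (disjoint_union I r) \<longleftrightarrow>
    (\<forall>\<phi>. condensing I r \<phi> \<longrightarrow> inj_on \<phi> I)"
    (is "?L = ?R")
proof -
  let ?P = "disjoint_union I r"
  have tot: "(x, y) \<in> r i \<or> (y, x) \<in> r i" if "i \<in> I" "x \<in> Field (r i)" "y \<in> Field (r i)" for i x y
    using lin[OF that(1)] that(2,3) by (metis order_on_defs(3) refl_on_def total_on_def order_on_defs(1,2))
  show ?thesis
  proof
    assume L: ?L
    show ?R
    proof clarify
      fix \<phi> assume \<phi>: "\<phi> ` I = I"
        and c: "\<forall>j\<in>I. condenses (disjoint_union {i \<in> I. \<phi> i = j} r) (r j)"
      obtain f where f: "bij_betw f (Field ?P) (Field ?P)" "compat ?P ?P f"
        and fst: "\<And>i x. fst (f (i, x)) = \<phi> i"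
        using condenses_fibrewise[of I I \<phi> r r] \<phi> c by blast
      have iso: "iso ?P ?P f" using L f by (auto simp: reversible_def)
      show "inj_on \<phi> I"
      proof (rule inj_onI)
        fix i k assume ik: "i \<in> I" "k \<in> I" "\<phi> i = \<phi> k"
        obtain x y where "x \<in> Field (r i)" "y \<in> Field (r k)"
          using ik ne Field_nonempty by metis
        then have F: "(i, x) \<in> Field ?P" "(k, y) \<in> Field ?P"
          using ik by (auto simp: Field_disjoint_union)
        then have "f (i, x) \<in> Field ?P" "f (k, y) \<in> Field ?P"
          using f(1) bij_betwE by blast+
        moreover obtain u v where uv: "f (i, x) = (\<phi> i, u)" "f (k, y) = (\<phi> i, v)"
          using fst ik(3) by (metis prod.collapse)
        \<comment> \<open>Both images lie in the component of \<open>\<phi> i\<close>, which is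
          total; an isomorphism carries their comparability back to the two points.\<close>
        ultimately have "(u, v) \<in> r (\<phi> i) \<or> (v, u) \<in> r (\<phi> i)" "\<phi> i \<in> I"
          using tot by (auto simp: Field_disjoint_union)
        then have "(f (i, x), f (k, y)) \<in> ?P \<or> (f (k, y), f (i, x)) \<in> ?P"
          using uv by (auto simp: disjoint_union_iff)
        then have "((i, x), (k, y)) \<in> ?P \<or> ((k, y), (i, x)) \<in> ?P"
          using iso F unfolding iso_iff2 by blast
        then show "i = k" by (auto simp: disjoint_union_iff)
      qed
    qed
  next
    assume R: ?R
    show ?L unfolding reversible_def
    proof clarify
      fix f assume bij: "bij_betw f (Field ?P) (Field ?P)" and comp: "compat ?P ?P f"
      \<comment> \<open>The choice of the point is immaterial: any two points of a component are
        comparable, hence so are their images.\<close>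
      define \<phi> where "\<phi> i = fst (f (i, SOME x. x \<in> Field (r i)))" for i
      have fst: "fst (f (i, x)) = \<phi> i" if "i \<in> I" "x \<in> Field (r i)" for i x
      proof -
        define y where "y = (SOME x. x \<in> Field (r i))"
        have y: "y \<in> Field (r i)" unfolding y_def using that(2) by (rule someI)
        have "(x, y) \<in> r i \<or> (y, x) \<in> r i" using tot that y by blast
        then have "(f (i, x), f (i, y)) \<in> ?P \<or> (f (i, y), f (i, x)) \<in> ?P"
          using comp that(1) by (auto simp: compat_def disjoint_union_iff)
        then show ?thesis by (auto simp: disjoint_union_def \<phi>_def y_def)
      qed
      have \<phi>: "\<phi> ` I = I"
      proof (intro equalityI subsetI)
        fix j assume "j \<in> \<phi> ` I"
        then obtain i where i: "i \<in> I" "j = \<phi> i" by auto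
        obtain x where x: "x \<in> Field (r i)" using ne i Field_nonempty by metis
        then have "f (i, x) \<in> Field ?P" using i bij_betwE[OF bij] by (auto simp: Field_disjoint_union)
        then show "j \<in> I" using fst[OF i(1) x] i by (auto simp: Field_disjoint_union)
      next
        fix j assume j: "j \<in> I"
        obtain y where y: "y \<in> Field (r j)" using ne j Field_nonempty by metis
        then have "(j, y) \<in> f ` Field ?P"
          using j bij_betw_imp_surj_on[OF bij] by (auto simp: Field_disjoint_union)
        then obtain i x where "i \<in> I" "x \<in> Field (r i)" "f (i, x) = (j, y)"
          by (auto simp: Field_disjoint_union)
        then show "j \<in> \<phi> ` I" using fst by force
      qed
      moreover have "condenses (disjoint_union {i \<in> I. \<phi> i = j} r) (r j)" if j: "j \<in> I" for j
      proof -
        let ?Q = "disjoint_union {i \<in> I. \<phi> i = j} r"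
        have sub: "Field ?Q \<subseteq> Field ?P" by (auto simp: Field_disjoint_union)
        have fstj: "fst (f p) = j" if "p \<in> Field ?Q" for p
          using fst that by (auto simp: Field_disjoint_union)
        \<comment> \<open>On this fibre the first coordinate of \<open>f\<close> is constantly
          \<open>j\<close>, so dropping it loses nothing.\<close>
        have "inj_on (snd \<circ> f) (Field ?Q)"
        proof (rule inj_onI, clarify)
          fix i x k y
          assume F: "(i, x) \<in> Field ?Q" "(k, y) \<in> Field ?Q" "(snd \<circ> f) (i, x) = (snd \<circ> f) (k, y)"
          then have "f (i, x) = f (k, y)" using fstj[OF F(1)] fstj[OF F(2)] by (simp add: prod_eq_iff)
          then show "i = k \<and> x = y"
            using inj_onD[OF bij_betw_imp_inj_on[OF bij]] F sub by blast
        qed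
        moreover have "(snd \<circ> f) ` Field ?Q = Field (r j)"
        proof (intro equalityI subsetI)
          fix y assume "y \<in> (snd \<circ> f) ` Field ?Q"
          then obtain i x where *: "(i, x) \<in> Field ?Q" "y = snd (f (i, x))" by auto
          then have "f (i, x) \<in> Field ?P" "f (i, x) = (j, y)"
            using fstj bij_betwE[OF bij] sub by (auto simp: prod_eq_iff)
          then have "(j, y) \<in> Field ?P" by simp
          then show "y \<in> Field (r j)" by (auto simp: Field_disjoint_union)
        next
          fix y assume "y \<in> Field (r j)"
          then have "(j, y) \<in> f ` Field ?P"
            using j bij_betw_imp_surj_on[OF bij] by (auto simp: Field_disjoint_union)
          then obtain i x where "i \<in> I" "x \<in> Field (r i)" "f (i, x) = (j, y)"
            by (auto simp: Field_disjoint_union)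
          moreover then have "\<phi> i = j" using fst by fastforce
          ultimately show "y \<in> (snd \<circ> f) ` Field ?Q"
            by (intro image_eqI[of _ _ "(i, x)"]) (simp_all add: Field_disjoint_union)
        qed
        moreover have "compat ?Q (r j) (snd \<circ> f)"
          unfolding compat_def
        proof clarify
          fix i x k y assume a: "((i, x), (k, y)) \<in> ?Q"
          then have F: "(i, x) \<in> Field ?Q" "(k, y) \<in> Field ?Q" by (auto intro: FieldI1 FieldI2)
          have "((i, x), (k, y)) \<in> ?P" using a by (auto simp: disjoint_union_iff)
          then have "(f (i, x), f (k, y)) \<in> ?P" by (rule compatD[OF comp])
          then show "((snd \<circ> f) (i, x), (snd \<circ> f) (k, y)) \<in> r j"
            using fstj[OF F(1)] fstj[OF F(2)]
            by (cases "f (i, x)"; cases "f (k, y)") (simp add: disjoint_union_iff)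
        qed
        ultimately show ?thesis unfolding condenses_def bij_betw_def by blast
      qed
      ultimately have inj: "inj_on \<phi> I" using R by blast
      show "iso ?P ?P f" unfolding iso_iff2
      proof (intro conjI bij ballI iffI)
        fix p q assume pq: "p \<in> Field ?P" "q \<in> Field ?P"
        {
          assume "(p, q) \<in> ?P"
          then show "(f p, f q) \<in> ?P" by (rule compatD[OF comp])
        next
          assume less: "(f p, f q) \<in> ?P"
          obtain i x k y where eq: "p = (i, x)" "q = (k, y)" by fastforce
          have ix: "i \<in> I" "x \<in> Field (r i)" and ky: "k \<in> I" "y \<in> Field (r k)"
            using pq eq by (auto simp: Field_disjoint_union)
          have "fst (f p) = fst (f q)" using less by (auto simp: disjoint_union_def)
          then have "\<phi> i = \<phi> k" using fst[OF ix] fst[OF ky] eq by simp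
          then have ik: "i = k" using inj ix ky by (auto dest: inj_onD)
          show "(p, q) \<in> ?P"
          proof (cases "(x, y) \<in> r i")
            case True
            then show ?thesis using eq ik ix by (auto simp: disjoint_union_iff)
          next
            case False
            \<comment> \<open>Otherwise \<open>q\<close> lies below \<open>p\<close>; then
              antisymmetry makes the images equal and injectivity gives
              \<open>p = q\<close>.\<close>
            then have "(q, p) \<in> ?P" using tot ix ky ik eq by (auto simp: disjoint_union_iff)
            then have "(f q, f p) \<in> ?P" by (rule compatD[OF comp])
            moreover have "antisym ?P"
              using Partial_order_disjoint_union[of I r] lin by (auto simp: order_on_defs)
            ultimately have "f p = f q" using less \<open>(f q, f p) \<in> ?P\<close> by (meson antisymD)
            then have "p = q" using pq inj_onD[OF bij_betw_imp_inj_on[OF bij]] by blast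
            then show ?thesis using \<open>(q, p) \<in> ?P\<close> by simp
          qed
        }
      qed
    qed
  qed
qed

section \<open>Reversed orders\<close>

lemma reversible_converse_iff: "reversible (P\<inverse>) \<longleftrightarrow> reversible P"
proof -
  have "compat (P\<inverse>) (P\<inverse>) f \<longleftrightarrow> compat P P f" for f
    by (auto simp only: compat_def converse_iff)
  moreover have "iso (P\<inverse>) (P\<inverse>) f \<longleftrightarrow> iso P P f" for f
    by (auto simp only: iso_iff2 converse_iff Field_converse)
  ultimately show ?thesis by (simp add: reversible_def)
qed

lemma disjoint_union_converse: "disjoint_union I (\<lambda>i. (r i)\<inverse>) = (disjoint_union I r)\<inverse>"
  by (auto simp: disjoint_union_def)

lemma compat_in_Field: "compat r s f \<Longrightarrow> x \<in> Field r \<Longrightarrow> f x \<in> Field s"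
  by (metis FieldI1 FieldI2 Field_iff compatD)

section \<open>Well orders without maximum\<close>

text \<open>If \<open>s\<close> were smaller, it would be isomorphic to a proper initial segment of
  \<open>r\<close>, and \<open>r\<close> would have a strictly increasing self-map moving some point
  down. No such map exists on a well order. Hence the image of \<open>f\<close> need not be an
  initial segment.\<close>

lemma ordLeq_if_compat:
  assumes r: "Well_order r" and s: "Well_order s" and f: "compat r s f" "inj_on f (Field r)"
  shows "r \<le>o s"
proof (rule ccontr)
  assume "\<not> r \<le>o s"
  then have "s <o r" using r s not_ordLeq_iff_ordLess by blast
  then obtain a where a: "a \<in> Field r" and "s =o Restr r (underS r a)"
    using ordLess_iff_ordIso_Restr[OF r s] by blast
  then obtain g where g: "iso s (Restr r (underS r a)) g" by (auto simp: ordIso_def)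
  define h where "h = g \<circ> f"
  have h_r: "(h x, h y) \<in> r" if "(x, y) \<in> r" for x y
    using that f(1) g unfolding h_def iso_iff2 compat_def
    by (metis (no_types, lifting) FieldI1 FieldI2 IntD1 comp_apply)
  have h_inj: "h x = h y \<longleftrightarrow> x = y" if "x \<in> Field r" "y \<in> Field r" for x y
    using that f g compat_in_Field[OF f(1)] unfolding h_def iso_iff2 bij_betw_def
    by (metis comp_apply inj_on_eq_iff)
  have "h a \<in> Field (Restr r (underS r a))"
    using a g compat_in_Field[OF f(1)] unfolding h_def iso_iff2 by (auto dest: bij_betwE)
  then have "h a \<in> underS r a" using subsetD[OF Field_Restr_subset] by metis
  then have a': "(h a, a) \<in> r - Id" by (auto simp: underS_def)
  \<comment> \<open>If \<open>h x\<close> is below \<open>x\<close>, then \<open>h (h x)\<close> is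
    below \<open>h x\<close>, so no least point is moved down.\<close>
  have "wf (r - Id)" using r by (auto simp: well_order_on_def)
  then show False using a'
  proof (induction a)
    case (less x)
    then have x: "(h x, x) \<in> r" "h x \<noteq> x" by auto
    then have "(h (h x), h x) \<in> r" "h (h x) \<noteq> h x"
      using h_r[OF x(1)] h_inj[OF FieldI1[OF x(1)] FieldI2[OF x(1)]] by auto
    then have "(h (h x), h x) \<in> r - Id" by simp
    then show ?case using less by blast
  qed
qed

lemma ordLeq_compat:
  assumes "r \<le>o s"
  obtains f where "compat r s f" "inj_on f (Field r)"
proof -
  obtain f where "Well_order r" "embed r s f" using assms by (auto simp: ordLeq_def)
  then show ?thesis using that embed_compat embed_inj_on by metis
qed

lemma Well_orderD:
  assumes "Well_order r"
  shows "wf (r - Id)" "\<And>x. x \<in> Field r \<Longrightarrow> (x, x) \<in> r"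
    and "\<And>x y. (x, y) \<in> r \<Longrightarrow> (y, x) \<in> r \<Longrightarrow> x = y"
    and "\<And>x y z. (x, y) \<in> r \<Longrightarrow> (y, z) \<in> r \<Longrightarrow> (x, z) \<in> r"
    and "\<And>x y. x \<in> Field r \<Longrightarrow> y \<in> Field r \<Longrightarrow> (x, y) \<in> r \<or> (y, x) \<in> r"
proof -
  interpret wo_rel r using assms by (simp add: wo_rel_def)
  show "wf (r - Id)" by (rule WF)
  show "(x, x) \<in> r" if "x \<in> Field r" for x using REFL that by (simp add: refl_on_def)
  show "x = y" if "(x, y) \<in> r" "(y, x) \<in> r" for x y using ANTISYM that by (rule antisymD)
  show "(x, z) \<in> r" if "(x, y) \<in> r" "(y, z) \<in> r" for x y z using TRANS that by (rule transD)
  show "(x, y) \<in> r \<or> (y, x) \<in> r" if "x \<in> Field r" "y \<in> Field r" for x y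
    using TOTALS that by blast
qed

text \<open>The empty order is unbounded as well.\<close>

definition unbounded :: "'a rel \<Rightarrow> bool" where
  "unbounded r \<longleftrightarrow> \<not> (\<exists>m \<in> Field r. \<forall>x \<in> Field r. (x, m) \<in> r)"

section \<open>Successors and disjoint copies of an unbounded well order inside itself\<close>

lemma unbounded_successor:
  assumes r: "Well_order r" "unbounded r"
  obtains s where "\<And>x. x \<in> Field r \<Longrightarrow> (x, s x) \<in> r - Id"
    and "\<And>x y. (x, y) \<in> r - Id \<Longrightarrow> (s x, y) \<in> r"
    and "inj_on s (Field r)"
proof -
  interpret wo_rel r using r by (simp add: wo_rel_def)
  note R = Well_orderD[OF r(1)]
  define s where "s x = suc {x}" for x
  have up: "(x, s x) \<in> r - Id" if x: "x \<in> Field r" for x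
  proof -
    \<comment> \<open>Unboundedness supplies a strict upper bound of \<open>x\<close>; only then is
      \<open>suc {x}\<close> meaningful.\<close>
    obtain y where y: "y \<in> Field r" "(y, x) \<notin> r" using r(2) x by (auto simp: unbounded_def)
    then have "(x, y) \<in> r" "x \<noteq> y" using R(2,5) x by blast+
    then have "AboveS {x} \<noteq> {}" using y by (auto simp: AboveS_def)
    then show ?thesis using suc_greater[of "{x}" x] x by (auto simp: s_def)
  qed
  have least: "(s x, y) \<in> r" if "(x, y) \<in> r - Id" for x y
    unfolding s_def using that by (intro suc_least_AboveS) (auto simp: AboveS_def intro: FieldI2)
  \<comment> \<open>From \<open>x\<close> below \<open>y\<close> it follows that \<open>s x\<close>
    is at most \<open>y\<close>, which is below \<open>s y\<close>.\<close>
  have lt: "s x \<noteq> s y" if "(x, y) \<in> r - Id" for x y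
  proof
    assume "s x = s y"
    moreover have "(y, s y) \<in> r - Id" using that up by (auto intro: FieldI2)
    ultimately show False using least[OF that] R(3) by auto
  qed
  have "inj_on s (Field r)"
  proof (rule inj_onI, rule ccontr)
    fix x y assume "x \<in> Field r" "y \<in> Field r" "s x = s y" "x \<noteq> y"
    then have "(x, y) \<in> r - Id \<or> (y, x) \<in> r - Id" using R(5) by blast
    then show False using lt \<open>s x = s y\<close> by metis
  qed
  then show ?thesis using that up least by blast
qed

text \<open>The successor map sends the elements above \<open>x\<close> injectively to elements
  strictly above \<open>x\<close>, which is impossible for a finite set.\<close>

lemma unbounded_infinite_above:
  assumes r: "Well_order r" "unbounded r" and x: "x \<in> Field r"
  shows "infinite {y. (x, y) \<in> r}"
proof
  assume fin: "finite {y. (x, y) \<in> r}"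
  note R = Well_orderD[OF r(1)]
  obtain s where s: "\<And>x. x \<in> Field r \<Longrightarrow> (x, s x) \<in> r - Id" and inj: "inj_on s (Field r)"
    using unbounded_successor[OF r] by metis
  have "s ` {y. (x, y) \<in> r} \<subseteq> {y. (x, y) \<in> r} - {x}"
  proof clarify
    fix y assume "(x, y) \<in> r"
    moreover then have "(y, s y) \<in> r - Id" using s by (auto intro: FieldI2)
    ultimately show "s y \<in> {y. (x, y) \<in> r} - {x}" using R(3,4) by blast
  qed
  moreover have "inj_on s {y. (x, y) \<in> r}" using inj by (auto simp: inj_on_def intro: FieldI2)
  ultimately have "card {y. (x, y) \<in> r} \<le> card ({y. (x, y) \<in> r} - {x})"
    using fin by (intro card_inj_on_le[of s]) auto
  then show False using card_Diff1_less[OF fin, of x] R(2)[OF x] by (meson leD mem_Collect_eq)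
qed

text \<open>The two embeddings are \<open>\<lambda> + k \<mapsto> \<lambda> + 2k\<close> and \<open>\<lambda> + k \<mapsto> \<lambda> + 2k + 1\<close>, for \<open>\<lambda>\<close> a limit or \<open>0\<close>.\<close>

lemma unbounded_two_embeddings:
  assumes r: "Well_order r" "unbounded r"
  obtains h k where "compat r r h" "inj_on h (Field r)" "compat r r k" "inj_on k (Field r)"
    and "\<And>x y. x \<in> Field r \<Longrightarrow> y \<in> Field r \<Longrightarrow> h x \<noteq> k y"
proof -
  note R = Well_orderD[OF r(1)]
  let ?L = "r - Id"
  obtain s where s: "\<And>x. x \<in> Field r \<Longrightarrow> (x, s x) \<in> ?L"
    and least: "\<And>x y. (x, y) \<in> ?L \<Longrightarrow> (s x, y) \<in> r" and inj: "inj_on s (Field r)"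
    using unbounded_successor[OF r] by metis
  have sF: "s x \<in> Field r" if "x \<in> Field r" for x using s[OF that] by (auto intro: FieldI2)
  have LF: "x \<in> Field r" "y \<in> Field r" if "(x, y) \<in> ?L" for x y
    using that by (auto intro: FieldI1 FieldI2)
  have tr1: "(x, z) \<in> ?L" if "(x, y) \<in> ?L" "(y, z) \<in> r" for x y z using that R(3,4) by blast
  have tr2: "(x, z) \<in> ?L" if "(x, y) \<in> r" "(y, z) \<in> ?L" for x y z using that R(3,4) by blast
  \<comment> \<open>The recursion doubles the successor steps: it adds two where the argument adds
    one and fixes every non-successor. The predecessor picked by \<open>THE\<close> is unique
    because \<open>s\<close> is injective.\<close>
  define H where "H f x = (if \<exists>y\<in>Field r. x = s y then
      s (s (f (THE y. y \<in> Field r \<and> x = s y))) else x)" for f x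
  define h where "h = wfrec ?L H"
  have h_rec: "h x = H (cut h ?L x) x" for x unfolding h_def by (rule wfrec[OF R(1)])
  have h_suc: "h (s y) = s (s (h y))" if y: "y \<in> Field r" for y
  proof -
    have the: "(THE z. z \<in> Field r \<and> s y = s z) = y"
      using y inj by (intro the_equality) (auto dest: inj_onD)
    have "h (s y) = s (s (cut h ?L (s y) y))"
      unfolding h_rec[of "s y"] H_def the using y by auto
    then show ?thesis using cut_apply[OF s[OF y]] by metis
  qed
  have h_lim: "h x = x" if "\<not> (\<exists>y\<in>Field r. x = s y)" for x
    using h_rec[of x] that by (simp add: H_def)
  have hF: "x \<in> Field r \<Longrightarrow> h x \<in> Field r" for x
    using R(1)
  proof (induction x)
    case (less x)
    show ?case
    proof (cases "\<exists>y\<in>Field r. x = s y")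
      case True
      then obtain y where "y \<in> Field r" "x = s y" by blast
      then show ?thesis using less.IH[of y] s sF h_suc by metis
    next
      case False then show ?thesis using h_lim less by simp
    qed
  qed
  \<comment> \<open>A point that is no successor is never reached by successor steps from below, so
    the doubled steps of \<open>h\<close> also stay below it.\<close>
  have below_lim: "(y, x) \<in> ?L \<Longrightarrow> (h y, x) \<in> ?L" if lim: "\<not> (\<exists>y\<in>Field r. x = s y)" for x y
    using R(1)
  proof (induction y)
    case (less y)
    have step: "(s z, x) \<in> ?L" if "(z, x) \<in> ?L" for z
      using least[OF that] lim LF(1)[OF that] by blast
    show ?case
    proof (cases "\<exists>z\<in>Field r. y = s z")
      case True
      then obtain z where z: "z \<in> Field r" "y = s z" by blast
      have zy: "(z, y) \<in> ?L" using s z by simp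
      then have "(z, x) \<in> ?L" using tr1 less.prems by blast
      then have "(h z, x) \<in> ?L" using less.IH zy by blast
      then show ?thesis using step z h_suc by metis
    next
      case False then show ?thesis using h_lim less.prems by simp
    qed
  qed
  have h_mono: "(x, y) \<in> ?L \<Longrightarrow> (h x, h y) \<in> ?L" for x y
    using R(1)
  proof (induction y)
    case (less y)
    show ?case
    proof (cases "\<exists>z\<in>Field r. y = s z")
      case True
      then obtain z where z: "z \<in> Field r" "y = s z" by blast
      \<comment> \<open>\<open>z\<close> is the predecessor of \<open>y\<close>, so anything below
        \<open>y\<close> is at most \<open>z\<close>.\<close>
      have "(x, z) \<in> r"
      proof (rule ccontr)
        assume "(x, z) \<notin> r"
        then have "(z, x) \<in> ?L" using R(2,5) z LF[OF less.prems] by blast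
        then have "(y, x) \<in> r" using least z by simp
        then show False using less.prems R(3) by blast
      qed
      then have "(h x, h z) \<in> r" using less.IH[of z] s[OF z(1)] z R(2) hF by (cases "x = z") auto
      moreover have "(h z, s (h z)) \<in> ?L" "(s (h z), s (s (h z))) \<in> ?L" using s sF hF z by auto
      ultimately have "(h x, s (s (h z))) \<in> ?L" using tr1 tr2 by blast
      then show ?thesis using h_suc z by simp
    next
      case False then show ?thesis using h_lim below_lim less.prems by simp
    qed
  qed
  define k where "k x = s (h x)" for x
  have k_mono: "(k x, k y) \<in> ?L" if "(x, y) \<in> ?L" for x y
    unfolding k_def using least[OF h_mono[OF that]] tr2 s hF LF[OF that] by blast
  have compat: "compat r r f" if "\<And>x y. (x, y) \<in> ?L \<Longrightarrow> (f x, f y) \<in> ?L"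
    and "\<And>x. x \<in> Field r \<Longrightarrow> f x \<in> Field r" for f
    unfolding compat_def
  proof (intro allI impI)
    fix x y assume "(x, y) \<in> r"
    then show "(f x, f y) \<in> r"
      using that R(2) FieldI1[of x y r] by (cases "x = y") auto
  qed
  have injective: "inj_on f (Field r)" if "\<And>x y. (x, y) \<in> ?L \<Longrightarrow> (f x, f y) \<in> ?L" for f
  proof (rule inj_onI, rule ccontr)
    fix x y assume "x \<in> Field r" "y \<in> Field r" "f x = f y" "x \<noteq> y"
    then have "(x, y) \<in> ?L \<or> (y, x) \<in> ?L" using R(5) by blast
    then have "(f x, f y) \<in> ?L \<or> (f y, f x) \<in> ?L" using that by blast
    then show False using \<open>f x = f y\<close> by auto
  qed
  \<comment> \<open>If \<open>x\<close> is at most \<open>y\<close>, then \<open>h x\<close> is at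
    most \<open>h y\<close>, hence below \<open>k y\<close>. If \<open>y\<close> is below
    \<open>x\<close>, then \<open>k y\<close> is below \<open>h (s y)\<close>, which is at most
    \<open>h x\<close>.\<close>
  have "h x \<noteq> k y" if xy: "x \<in> Field r" "y \<in> Field r" for x y
  proof
    assume eq: "h x = k y"
    have hy: "(h y, k y) \<in> ?L" unfolding k_def using s hF xy by simp
    consider "x = y" | "(x, y) \<in> ?L" | "(y, x) \<in> ?L" using R(5) xy by blast
    then show False
    proof cases
      case 1 then show False using hy eq by simp
    next
      case 2
      then have "(h x, k y) \<in> ?L" using h_mono hy tr1 by blast
      then show False using eq by simp
    next
      case 3
      then have "(s y, x) \<in> r" using least by blast
      then have "(h (s y), h x) \<in> r" using h_mono R(2) hF xy by (cases "s y = x") auto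
      moreover have "(k y, h (s y)) \<in> ?L" using h_suc s sF hF xy by (simp add: k_def)
      ultimately have "(k y, h x) \<in> ?L" using tr1 by blast
      then show False using eq by simp
    qed
  qed
  moreover have "compat r r h" "compat r r k"
    by (intro compat h_mono k_mono hF; simp add: k_def sF hF)+
  moreover have "inj_on h (Field r)" "inj_on k (Field r)"
    by (intro injective h_mono k_mono; assumption)+
  ultimately show ?thesis using that by metis
qed

text \<open>The embeddings \<open>k\<close>, \<open>h \<circ> k\<close>,
  \<open>h \<circ> h \<circ> k\<close>, ... have disjoint images, since those of \<open>h\<close>
  and \<open>k\<close> are disjoint and the powers of \<open>h\<close> are injective.\<close>

lemma unbounded_disjoint_embeddings:
  assumes r: "Well_order r" "unbounded r"
  obtains e :: "nat \<Rightarrow> 'a \<Rightarrow> 'a"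
  where "\<And>n. compat r r (e n)" "\<And>n. inj_on (e n) (Field r)"
    and "\<And>m n x y. m \<noteq> n \<Longrightarrow> x \<in> Field r \<Longrightarrow> y \<in> Field r \<Longrightarrow> e m x \<noteq> e n y"
proof -
  obtain h k where h: "compat r r h" "inj_on h (Field r)" and k: "compat r r k" "inj_on k (Field r)"
    and disj: "\<And>x y. x \<in> Field r \<Longrightarrow> y \<in> Field r \<Longrightarrow> h x \<noteq> k y"
    using unbounded_two_embeddings[OF r] by metis
  have ch: "compat r r (h ^^ n)" for n
    by (induction n) (use h in \<open>auto simp: compat_def\<close>)
  have ih: "inj_on (h ^^ n) (Field r)" for n
  proof (induction n)
    case (Suc n)
    have "(h ^^ n) ` Field r \<subseteq> Field r" using compat_in_Field[OF ch] by (rule image_subsetI)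
    then show ?case unfolding funpow.simps
      by (intro comp_inj_on[OF Suc] inj_on_subset[OF h(2)])
  qed simp
  define e where "e n = (h ^^ n) \<circ> k" for n
  have "compat r r (e n)" for n using ch k by (auto simp: e_def compat_def)
  moreover have "inj_on (e n) (Field r)" for n
    unfolding e_def using compat_in_Field[OF k(1)]
    by (intro comp_inj_on[OF k(2)] inj_on_subset[OF ih]) auto
  moreover have lt: "e m x \<noteq> e n y" if "m < n" and xy: "x \<in> Field r" "y \<in> Field r" for m n x y
  proof
    assume eq: "e m x = e n y"
    obtain d where d: "n = m + Suc d" using \<open>m < n\<close> less_iff_Suc_add by auto
    have kF: "k x \<in> Field r" "k y \<in> Field r" using compat_in_Field[OF k(1)] xy by auto
    then have dF: "(h ^^ d) (k y) \<in> Field r" using compat_in_Field[OF ch] by auto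
    then have "h ((h ^^ d) (k y)) \<in> Field r" using compat_in_Field[OF h(1)] by auto
    \<comment> \<open>Cancelling the \<open>m\<close> common applications of \<open>h\<close> leaves
      a value of \<open>k\<close> equal to a value of \<open>h\<close>.\<close>
    moreover have "(h ^^ m) (k x) = (h ^^ m) (h ((h ^^ d) (k y)))"
      using eq d by (simp add: e_def funpow_add funpow_swap1)
    ultimately have "k x = h ((h ^^ d) (k y))" using ih kF by (meson inj_onD)
    then show False using disj[OF dF xy(1)] by simp
  qed
  moreover have "e m x \<noteq> e n y" if "m \<noteq> n" "x \<in> Field r" "y \<in> Field r" for m n x y
    using lt[of m n x y] lt[of n m y x] that by (metis nat_neq_iff)
  ultimately show ?thesis using that by blast
qed

text \<open>The member \<open>s i0\<close> takes up everything that disjoint copies of the other \<open>s i\<close> leave over; as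
  the remainder still contains a copy of \<open>r\<close>, its type is \<open>r\<close>.\<close>

lemma condenses_unbounded:
  assumes r: "Well_order r" "unbounded r" and F: "finite F" "i0 \<in> F"
    and s0: "s i0 =o r" and s: "\<And>i. i \<in> F \<Longrightarrow> s i \<le>o r"
  shows "condenses (disjoint_union F s) r"
proof -
  obtain e :: "nat \<Rightarrow> _" where e: "\<And>n. compat r r (e n)" "\<And>n. inj_on (e n) (Field r)"
    and disj: "\<And>m n x y. m \<noteq> n \<Longrightarrow> x \<in> Field r \<Longrightarrow> y \<in> Field r \<Longrightarrow> e m x \<noteq> e n y"
    using unbounded_disjoint_embeddings[OF r] by metis
  obtain c :: "_ \<Rightarrow> nat" where c: "inj_on c F" using finite_imp_inj_to_nat_seg[OF F(1)] by blast
  have "\<forall>i\<in>F. \<exists>d. compat (s i) r d \<and> inj_on d (Field (s i))"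
    using ordLeq_compat[OF s] by metis
  from bchoice[OF this] obtain d where d: "\<And>i. i \<in> F \<Longrightarrow> compat (s i) r (d i)"
    "\<And>i. i \<in> F \<Longrightarrow> inj_on (d i) (Field (s i))" by blast
  \<comment> \<open>The number \<open>c i\<close> reserves one of the disjoint copies of
    \<open>r\<close> for the index \<open>i\<close>.\<close>
  define E where "E i = e (c i) \<circ> d i" for i
  have dF: "d i x \<in> Field r" if "i \<in> F" "x \<in> Field (s i)" for i x
    using compat_in_Field[OF d(1)] that by blast
  have E: "compat (s i) r (E i)" "inj_on (E i) (Field (s i))" if "i \<in> F" for i
  proof -
    show "compat (s i) r (E i)" using d(1)[OF that] e(1) by (simp add: E_def compat_def)
    have "d i ` Field (s i) \<subseteq> Field r" using dF that by blast
    then show "inj_on (E i) (Field (s i))" unfolding E_def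
      by (intro comp_inj_on[OF d(2)[OF that]] inj_on_subset[OF e(2)])
  qed
  have E_disj: "E i x \<noteq> E k y" if "i \<noteq> k" "i \<in> F" "k \<in> F" "x \<in> Field (s i)" "y \<in> Field (s k)"
    for i k x y
    unfolding E_def comp_apply using that inj_onD[OF c] dF by (intro disj) auto
  define C where "C = Field r - (\<Union>i\<in>F - {i0}. E i ` Field (s i))"
  define R where "R = Restr r C"
  have FR: "Field R = C" unfolding R_def
    by (rule Refl_Field_Restr2) (use r in \<open>auto simp: C_def order_on_defs well_order_on_def\<close>)
  have WR: "Well_order R" unfolding R_def using r(1) by (rule Well_order_Restr)
  have E0: "E i0 x \<in> C" if "x \<in> Field (s i0)" for x
    using compat_in_Field[OF E(1)[OF F(2)] that] E_disj F(2) that by (fastforce simp: C_def)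
  have W0: "Well_order (s i0)" using s0 by (simp add: ordIso_def)
  have "compat (s i0) R (E i0)" unfolding compat_def
  proof (intro allI impI)
    fix x y assume "(x, y) \<in> s i0"
    moreover from this have "E i0 x \<in> C" "E i0 y \<in> C" using E0 by (auto intro: FieldI1 FieldI2)
    ultimately show "(E i0 x, E i0 y) \<in> R" using compatD[OF E(1)[OF F(2)]] by (simp add: R_def)
  qed
  then have "s i0 \<le>o R" using ordLeq_if_compat[OF W0 WR] E(2) F(2) by blast
  moreover have "R \<le>o r" by (rule ordLeq_if_compat[OF WR r(1), of id]) (auto simp: compat_def R_def)
  ultimately have "s i0 =o R"
    using s0 by (meson ordIso_iff_ordLeq ordIso_symmetric ordLeq_ordIso_trans)
  then obtain u where "iso (s i0) R u" by (auto simp: ordIso_def)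
  then have u: "bij_betw u (Field (s i0)) C" and uR: "\<And>x y. (x, y) \<in> s i0 \<Longrightarrow> (u x, u y) \<in> r"
    unfolding iso_iff2 FR by (auto simp: R_def dest: FieldI1 FieldI2)
  \<comment> \<open>At \<open>i0\<close> the map \<open>u\<close> replaces \<open>E i0\<close>,
    because \<open>u\<close> is onto the remainder \<open>C\<close> while \<open>E i0\<close> need
    not be.\<close>
  define g where "g = (\<lambda>(i, x). if i = i0 then u x else E i x)"
  have "inj_on g (SIGMA i:F. Field (s i))"
  proof (rule inj_onI, clarify)
    fix i x k y
    assume *: "i \<in> F" "x \<in> Field (s i)" "k \<in> F" "y \<in> Field (s k)" "g (i, x) = g (k, y)"
    have u0: "u z \<noteq> E l w" if "z \<in> Field (s i0)" "l \<in> F" "l \<noteq> i0" "w \<in> Field (s l)" for z l w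
      using bij_betwE[OF u] that by (auto simp: C_def)
    show "i = k \<and> x = y"
    proof (cases "i = k")
      case True
      show ?thesis
      proof (cases "i = i0")
        case True
        then have "u x = u y" using * \<open>i = k\<close> by (simp add: g_def)
        then show ?thesis using * True \<open>i = k\<close> inj_onD[OF bij_betw_imp_inj_on[OF u]] by simp
      next
        case False
        then have "E i x = E i y" using * \<open>i = k\<close> by (simp add: g_def)
        then show ?thesis using * \<open>i = k\<close> inj_onD[OF E(2)] by simp
      qed
    next
      case False
      then have False
        using * u0[of x k y] u0[of y i x] E_disj[of i k x y] by (auto simp: g_def split: if_splits)
      then show ?thesis ..
    qed
  qed
  moreover have "g ` (SIGMA i:F. Field (s i)) = Field r"
  proof (intro equalityI subsetI)
    fix z assume "z \<in> g ` (SIGMA i:F. Field (s i))"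
    then obtain i x where ix: "i \<in> F" "x \<in> Field (s i)" "z = g (i, x)" by auto
    have "u x \<in> Field r" if "i = i0" using bij_betwE[OF u] ix that by (auto simp: C_def)
    then show "z \<in> Field r" using compat_in_Field[OF E(1)] ix by (auto simp: g_def)
  next
    fix z assume z: "z \<in> Field r"
    show "z \<in> g ` (SIGMA i:F. Field (s i))"
    proof (cases "z \<in> C")
      case True
      then obtain x where "x \<in> Field (s i0)" "z = u x" using bij_betw_imp_surj_on[OF u] by blast
      then show ?thesis using F(2) by (intro image_eqI[of _ _ "(i0, x)"]) (auto simp: g_def)
    next
      case False
      then obtain i x where "i \<in> F" "i \<noteq> i0" "x \<in> Field (s i)" "z = E i x"
        using z by (auto simp: C_def)
      then show ?thesis by (intro image_eqI[of _ _ "(i, x)"]) (auto simp: g_def)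
    qed
  qed
  moreover have "compat (disjoint_union F s) r g"
    using uR compatD[OF E(1)] by (auto simp: compat_def disjoint_union_iff g_def)
  ultimately show ?thesis unfolding condenses_def Field_disjoint_union bij_betw_def by blast
qed

section \<open>Ordinal sums\<close>

lemma Field_ordinal_sum: "Field (ordinal_sum r s) = Inl ` Field r \<union> Inr ` Field s"
  by (fastforce simp: ordinal_sum_def Field_def)

lemma ordinal_sum_iff:
  "(Inl x, Inl x') \<in> ordinal_sum r s \<longleftrightarrow> (x, x') \<in> r"
  "(Inr y, Inr y') \<in> ordinal_sum r s \<longleftrightarrow> (y, y') \<in> s"
  "(Inl x, Inr y) \<in> ordinal_sum r s \<longleftrightarrow> x \<in> Field r \<and> y \<in> Field s"
  "(Inr y, Inl x) \<notin> ordinal_sum r s"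
  by (auto simp: ordinal_sum_def)

lemma compat_ordinal_sumI:
  assumes "\<And>x x'. (x, x') \<in> r \<Longrightarrow> (f (Inl x), f (Inl x')) \<in> t"
    and "\<And>y y'. (y, y') \<in> s \<Longrightarrow> (f (Inr y), f (Inr y')) \<in> t"
    and "\<And>x y. x \<in> Field r \<Longrightarrow> y \<in> Field s \<Longrightarrow> (f (Inl x), f (Inr y)) \<in> t"
  shows "compat (ordinal_sum r s) t f"
  using assms by (auto simp: compat_def ordinal_sum_def)

text \<open>Lower and upper parts are matched separately. Pairs across the two parts cause no
  difficulty, as every \<open>Inl\<close> of the target lies below every \<open>Inr\<close>.\<close>

lemma condenses_ordinal_sum:
  assumes "condenses (disjoint_union F r) r'" "condenses (disjoint_union F s) s'"
  shows "condenses (disjoint_union F (\<lambda>i. ordinal_sum (r i) (s i))) (ordinal_sum r' s')"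
proof -
  obtain a where a: "bij_betw a (SIGMA i:F. Field (r i)) (Field r')" "compat (disjoint_union F r) r' a"
    using assms by (auto simp: condenses_def Field_disjoint_union)
  obtain b where b: "bij_betw b (SIGMA i:F. Field (s i)) (Field s')" "compat (disjoint_union F s) s' b"
    using assms by (auto simp: condenses_def Field_disjoint_union)
  define g where "g = (\<lambda>(i, z). case z of Inl x \<Rightarrow> Inl (a (i, x)) | Inr y \<Rightarrow> Inr (b (i, y)))"
  let ?S = "SIGMA i:F. Inl ` Field (r i) \<union> Inr ` Field (s i)"
  have "inj_on g ?S"
  proof (rule inj_onI, clarify)
    fix i z k w
    assume "i \<in> F" "z \<in> Inl ` Field (r i) \<union> Inr ` Field (s i)"
      "k \<in> F" "w \<in> Inl ` Field (r k) \<union> Inr ` Field (s k)" "g (i, z) = g (k, w)"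
    then show "i = k \<and> z = w"
      using inj_onD[OF bij_betw_imp_inj_on[OF a(1)]] inj_onD[OF bij_betw_imp_inj_on[OF b(1)]]
      by (cases z; cases w) (auto simp: g_def)
  qed
  moreover have "g ` ?S = Inl ` Field r' \<union> Inr ` Field s'"
  proof (intro equalityI subsetI)
    fix z assume "z \<in> g ` ?S"
    then show "z \<in> Inl ` Field r' \<union> Inr ` Field s'"
      using bij_betwE[OF a(1)] bij_betwE[OF b(1)] by (auto simp: g_def)
  next
    fix z assume "z \<in> Inl ` Field r' \<union> Inr ` Field s'"
    then consider x where "z = Inl x" "x \<in> Field r'" | y where "z = Inr y" "y \<in> Field s'" by blast
    then show "z \<in> g ` ?S"
    proof cases
      case 1
      then have "x \<in> a ` (SIGMA i:F. Field (r i))" using bij_betw_imp_surj_on[OF a(1)] by simp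
      then obtain i u where "i \<in> F" "u \<in> Field (r i)" "x = a (i, u)" by auto
      then show ?thesis using 1 by (intro image_eqI[of _ _ "(i, Inl u)"]) (auto simp: g_def)
    next
      case 2
      then have "y \<in> b ` (SIGMA i:F. Field (s i))" using bij_betw_imp_surj_on[OF b(1)] by simp
      then obtain i u where "i \<in> F" "u \<in> Field (s i)" "y = b (i, u)" by auto
      then show ?thesis using 2 by (intro image_eqI[of _ _ "(i, Inr u)"]) (auto simp: g_def)
    qed
  qed
  moreover have "compat (disjoint_union F (\<lambda>i. ordinal_sum (r i) (s i))) (ordinal_sum r' s') g"
    unfolding compat_def
  proof clarify
    fix i z k w assume *: "((i, z), (k, w)) \<in> disjoint_union F (\<lambda>i. ordinal_sum (r i) (s i))"
    have "a (i, x) \<in> Field r'" if "i \<in> F" "x \<in> Field (r i)" for i x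
      using bij_betwE[OF a(1)] that by blast
    moreover have "b (i, y) \<in> Field s'" if "i \<in> F" "y \<in> Field (s i)" for i y
      using bij_betwE[OF b(1)] that by blast
    moreover have "(a (i, x), a (i, y)) \<in> r'" if "i \<in> F" "(x, y) \<in> r i" for i x y
      using that by (intro compatD[OF a(2)]) (simp add: disjoint_union_iff)
    moreover have "(b (i, x), b (i, y)) \<in> s'" if "i \<in> F" "(x, y) \<in> s i" for i x y
      using that by (intro compatD[OF b(2)]) (simp add: disjoint_union_iff)
    ultimately show "(g (i, z), g (k, w)) \<in> ordinal_sum r' s'"
      using * by (cases z; cases w) (auto simp: disjoint_union_iff g_def ordinal_sum_iff)
  qed
  ultimately show ?thesis
    unfolding condenses_def Field_disjoint_union Field_ordinal_sum bij_betw_def by blast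
qed

text \<open>Intervals of lengths \<open>n i\<close> are laid end to end.\<close>

lemma condenses_natLeq_on:
  assumes "finite F"
  shows "condenses (disjoint_union F (\<lambda>i. natLeq_on (n i))) (natLeq_on (sum n F))"
proof -
  have "\<exists>f. bij_betw f (SIGMA i:F. {..<n i}) {..<sum n F} \<and>
      (\<forall>i x y. i \<in> F \<longrightarrow> x \<le> y \<longrightarrow> y < n i \<longrightarrow> f (i, x) \<le> f (i, y))"
    using assms
  proof (induction F)
    case empty
    then show ?case by (auto simp: bij_betw_def)
  next
    case (insert i F)
    then obtain f where f: "bij_betw f (SIGMA i:F. {..<n i}) {..<sum n F}"
      and mono: "\<And>i x y. i \<in> F \<Longrightarrow> x \<le> y \<Longrightarrow> y < n i \<Longrightarrow> f (i, x) \<le> f (i, y)" by blast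
    \<comment> \<open>The new interval starts at \<open>sum n F\<close>, right after those already
      placed.\<close>
    define g where "g = (\<lambda>(k, x). if k = i then sum n F + x else f (k, x))"
    have "bij_betw g ({i} \<times> {..<n i}) {sum n F..<sum n F + n i}"
      by (rule bij_betw_byWitness[where f' = "\<lambda>x. (i, x - sum n F)"]) (auto simp: g_def)
    moreover have "bij_betw g (SIGMA i:F. {..<n i}) {..<sum n F}"
      using f by (subst bij_betw_cong[of _ g f]) (use insert in \<open>auto simp: g_def\<close>)
    ultimately have "bij_betw g ({i} \<times> {..<n i} \<union> (SIGMA i:F. {..<n i}))
        ({sum n F..<sum n F + n i} \<union> {..<sum n F})"
      by (rule bij_betw_combine) auto
    moreover have "{i} \<times> {..<n i} \<union> (SIGMA i:F. {..<n i}) = (SIGMA i:insert i F. {..<n i})" by auto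
    moreover have "{sum n F..<sum n F + n i} \<union> {..<sum n F} = {..<sum n (insert i F)}"
      using insert by auto
    moreover have "\<forall>k x y. k \<in> insert i F \<longrightarrow> x \<le> y \<longrightarrow> y < n k \<longrightarrow> g (k, x) \<le> g (k, y)"
      using mono by (auto simp: g_def)
    ultimately show ?case by auto
  qed
  then obtain f where f: "bij_betw f (SIGMA i:F. {..<n i}) {..<sum n F}"
    and mono: "\<And>i x y. i \<in> F \<Longrightarrow> x \<le> y \<Longrightarrow> y < n i \<Longrightarrow> f (i, x) \<le> f (i, y)" by blast
  have "compat (disjoint_union F (\<lambda>i. natLeq_on (n i))) (natLeq_on (sum n F)) f"
    unfolding compat_def
  proof clarify
    fix i x k y assume "((i, x), (k, y)) \<in> disjoint_union F (\<lambda>i. natLeq_on (n i))"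
    then have *: "k = i" "i \<in> F" "x < n i" "y < n i" "x \<le> y" by (auto simp: disjoint_union_iff)
    then have "f (i, x) \<in> {..<sum n F}" "f (i, y) \<in> {..<sum n F}" using bij_betwE[OF f] by auto
    then show "f (i, x) < sum n F \<and> f (k, y) < sum n F \<and> f (i, x) \<le> f (k, y)"
      using * mono by auto
  qed
  then show ?thesis
    using f unfolding condenses_def Field_disjoint_union Field_natLeq_on lessThan_def by blast
qed

text \<open>The finite parts of ordinals \<open>\<gamma> + n i\<close> add up because a condensation matches exactly the
  elements with finitely many elements above them: the other elements have infinitely many above
  them, and an element of the finite part has a copy of \<open>\<gamma>\<close> below it.\<close>

lemma condenses_ordinal_sum_natLeq_onD:
  fixes r :: "'i \<Rightarrow> 'a rel" and c :: "'b rel"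
  assumes c: "Well_order c" and iso: "\<And>i. i \<in> F \<Longrightarrow> r i =o c"
    and unb: "\<And>i. i \<in> F \<Longrightarrow> unbounded (r i)" and pos: "\<And>i. i \<in> F \<Longrightarrow> n i > 0"
    and cond: "condenses (disjoint_union F (\<lambda>i. ordinal_sum (r i) (natLeq_on (n i))))
      (ordinal_sum c (natLeq_on N))"
  shows "finite F \<and> sum n F = N"
proof -
  let ?P = "disjoint_union F (\<lambda>i. ordinal_sum (r i) (natLeq_on (n i)))"
  let ?Q = "ordinal_sum c (natLeq_on N)"
  obtain f where f: "bij_betw f (Field ?P) (Field ?Q)" "compat ?P ?Q f"
    using cond by (auto simp: condenses_def)
  have FP: "Field ?P = (SIGMA i:F. Inl ` Field (r i) \<union> Inr ` {..<n i})"
    by (auto simp: Field_disjoint_union Field_ordinal_sum Field_natLeq_on)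
  have FQ: "Field ?Q = Inl ` Field c \<union> Inr ` {..<N}"
    by (auto simp: Field_ordinal_sum Field_natLeq_on)
  have fmono: "(f (i, z), f (i, w)) \<in> ?Q"
    if "i \<in> F" "(z, w) \<in> ordinal_sum (r i) (natLeq_on (n i))" for i z w
    using that by (intro compatD[OF f(2)]) (simp add: disjoint_union_iff)
  have finj: "f p \<noteq> f q" if "p \<in> Field ?P" "q \<in> Field ?P" "p \<noteq> q" for p q
    using that f(1) by (meson bij_betw_def inj_onD)
  have top: "\<exists>k<N. f (i, Inr m) = Inr k" if i: "i \<in> F" and m: "m < n i" for i m
  proof (rule ccontr)
    assume "\<not> ?thesis"
    moreover have "f (i, Inr m) \<in> Field ?Q"
      by (rule bij_betwE[OF f(1), rule_format]) (use i m in \<open>auto simp: FP\<close>)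
    ultimately obtain y where y: "f (i, Inr m) = Inl y" "y \<in> Field c" by (auto simp: FQ)
    \<comment> \<open>The copy of \<open>c\<close> in the component \<open>i\<close> would be
      carried strictly below \<open>y\<close>, making \<open>c\<close> smaller than itself.\<close>
    have "\<exists>x'. f (i, Inl x) = Inl x' \<and> x' \<in> underS c y" if x: "x \<in> Field (r i)" for x
    proof -
      have "(f (i, Inl x), Inl y) \<in> ?Q"
        using fmono[OF i, of "Inl x" "Inr m"] x m y by (auto simp: ordinal_sum_iff Field_natLeq_on)
      moreover have "f (i, Inl x) \<noteq> Inl y"
        using finj[of "(i, Inl x)" "(i, Inr m)"] x i m y by (auto simp: FP)
      ultimately show ?thesis by (cases "f (i, Inl x)") (auto simp: ordinal_sum_iff underS_def)
    qed
    then obtain q where q: "\<And>x. x \<in> Field (r i) \<Longrightarrow> f (i, Inl x) = Inl (q x)"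
      "\<And>x. x \<in> Field (r i) \<Longrightarrow> q x \<in> underS c y" by metis
    have "compat (r i) (Restr c (underS c y)) q" unfolding compat_def
    proof (intro allI impI)
      fix x x' assume x: "(x, x') \<in> r i"
      then have "(f (i, Inl x), f (i, Inl x')) \<in> ?Q" using i by (intro fmono) (auto simp: ordinal_sum_iff)
      then show "(q x, q x') \<in> Restr c (underS c y)"
        using q[OF FieldI1[OF x]] q[OF FieldI2[OF x]] by (simp add: ordinal_sum_iff)
    qed
    moreover have "inj_on q (Field (r i))"
    proof (rule inj_onI, rule ccontr)
      fix x x' assume "x \<in> Field (r i)" "x' \<in> Field (r i)" "q x = q x'" "x \<noteq> x'"
      then show False using finj[of "(i, Inl x)" "(i, Inl x')"] i q by (auto simp: FP)
    qed
    moreover have "Well_order (r i)" "Well_order (Restr c (underS c y))"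
      using iso[OF i] c by (auto simp: ordIso_def intro: Well_order_Restr)
    ultimately have "r i \<le>o Restr c (underS c y)" by (intro ordLeq_if_compat)
    also have "Restr c (underS c y) <o c" using c y(2) by (intro underS_Restr_ordLess) auto
    finally show False using iso[OF i] not_ordLess_ordIso by blast
  qed
  have bot: "\<exists>y\<in>Field c. f (i, Inl x) = Inl y" if i: "i \<in> F" and x: "x \<in> Field (r i)" for i x
  proof (rule ccontr)
    assume "\<not> ?thesis"
    moreover have "f (i, Inl x) \<in> Field ?Q"
      by (rule bij_betwE[OF f(1), rule_format]) (use i x in \<open>auto simp: FP\<close>)
    ultimately obtain k where k: "f (i, Inl x) = Inr k" by (auto simp: FQ)
    let ?Y = "{y. (x, y) \<in> r i}"
    \<comment> \<open>No \<open>Inl\<close> lies above an \<open>Inr\<close>, so infinitely many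
      elements would go injectively into a finite set.\<close>
    have "(\<lambda>y. f (i, Inl y)) ` ?Y \<subseteq> Inr ` {..<N}"
    proof clarify
      fix y assume "(x, y) \<in> r i"
      then have "(f (i, Inl x), f (i, Inl y)) \<in> ?Q" using i by (intro fmono) (auto simp: ordinal_sum_iff)
      then show "f (i, Inl y) \<in> Inr ` {..<N}"
        using k by (cases "f (i, Inl y)") (auto simp: ordinal_sum_iff)
    qed
    then have "finite ((\<lambda>y. f (i, Inl y)) ` ?Y)" by (rule finite_subset) simp
    moreover have "inj_on (\<lambda>y. f (i, Inl y)) ?Y"
    proof (rule inj_onI, rule ccontr)
      fix u v assume "u \<in> ?Y" "v \<in> ?Y" and eq: "f (i, Inl u) = f (i, Inl v)" "u \<noteq> v"
      then have "u \<in> Field (r i)" "v \<in> Field (r i)" by (auto intro: FieldI2)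
      then show False using finj[of "(i, Inl u)" "(i, Inl v)"] i eq by (auto simp: FP)
    qed
    ultimately have "finite ?Y" by (rule finite_imageD)
    moreover have "Well_order (r i)" using iso[OF i] by (simp add: ordIso_def)
    ultimately show False using unbounded_infinite_above[OF _ unb[OF i] x] by blast
  qed
  let ?T = "(SIGMA i:F. Inr ` {..<n i}) :: ('i \<times> ('a + nat)) set"
  have "f ` ?T = Inr ` {..<N}"
  proof (intro equalityI subsetI)
    fix z assume "z \<in> f ` ?T"
    then obtain i m where "i \<in> F" "m < n i" "z = f (i, Inr m)" by auto
    then show "z \<in> Inr ` {..<N}" using top by auto
  next
    fix z :: "'b + nat" assume z: "z \<in> Inr ` {..<N}"
    then have "z \<in> f ` Field ?P" using bij_betw_imp_surj_on[OF f(1)] FQ by auto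
    then obtain i w where iw: "i \<in> F" "w \<in> Inl ` Field (r i) \<union> Inr ` {..<n i}" "z = f (i, w)"
      unfolding FP by auto
    have "w \<noteq> Inl x" if x: "x \<in> Field (r i)" for x
    proof
      assume "w = Inl x"
      moreover obtain y where "f (i, Inl x) = Inl y" using bot[OF iw(1) x] by blast
      ultimately show False using z iw(3) by auto
    qed
    then have "w \<in> Inr ` {..<n i}" using iw(2) by blast
    then show "z \<in> f ` ?T" using iw by blast
  qed
  moreover have "inj_on f ?T"
    by (rule inj_on_subset[OF bij_betw_imp_inj_on[OF f(1)]]) (auto simp: FP)
  ultimately have bij: "bij_betw f ?T (Inr ` {..<N})" by (simp add: bij_betw_def)
  then have finT: "finite ?T" using bij_betw_finite by blast
  \<comment> \<open>Since each \<open>n i\<close> is positive, every index is seen in the finite set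
    \<open>?T\<close>.\<close>
  have "F \<subseteq> fst ` ?T"
  proof
    fix i assume "i \<in> F"
    then show "i \<in> fst ` ?T" using pos by (intro image_eqI[of _ _ "(i, Inr 0)"]) auto
  qed
  then have fin: "finite F" using finT finite_surj by blast
  have "card ?T = sum n F" using fin by (simp add: card_image)
  moreover have "card ?T = N" using bij_betw_same_card[OF bij] by (simp add: card_image)
  ultimately show ?thesis using fin by simp
qed

section \<open>Comparison of ordinal sums\<close>

lemma ordLeq_ordinal_sum:
  assumes "a =o ordinal_sum r s" "Well_order r" shows "r \<le>o a"
proof -
  have "r \<le>o ordinal_sum r s"
    using assms by (intro ordLeq_if_compat[where f = Inl]) (auto simp: ordIso_def compat_def ordinal_sum_iff)
  then show ?thesis using assms(1) by (meson ordIso_symmetric ordLeq_ordIso_trans)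
qed

lemma ordIso_ordinal_sum_0:
  assumes "a =o ordinal_sum r (natLeq_on 0)" "Well_order r" shows "a =o r"
proof -
  have F: "Field (ordinal_sum r (natLeq_on 0)) = Inl ` Field r"
    unfolding Field_ordinal_sum Field_natLeq_on by simp
  have "ordinal_sum r (natLeq_on 0) \<le>o r"
  proof (rule ordLeq_if_compat[OF _ assms(2)])
    show "Well_order (ordinal_sum r (natLeq_on 0))" using assms(1) unfolding ordIso_def by blast
    show "compat (ordinal_sum r (natLeq_on 0)) r projl" by (rule compat_ordinal_sumI) auto
    show "inj_on projl (Field (ordinal_sum r (natLeq_on 0)))" unfolding F by (auto simp: inj_on_def)
  qed
  then show ?thesis using ordLeq_ordinal_sum[OF assms] assms(1)
    by (meson ordIso_iff_ordLeq ordIso_ordLeq_trans)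
qed

lemma ordinal_sum_ordLeq_mono:
  assumes "Well_order (ordinal_sum r s)" "Well_order (ordinal_sum r' s)" "r \<le>o r'"
  shows "ordinal_sum r s \<le>o ordinal_sum r' s"
proof -
  obtain f where f: "compat r r' f" "inj_on f (Field r)" using ordLeq_compat assms(3) by blast
  show ?thesis
  proof (rule ordLeq_if_compat[OF assms(1,2)])
    show "compat (ordinal_sum r s) (ordinal_sum r' s) (map_sum f id)"
      using f(1) by (intro compat_ordinal_sumI) (auto simp: ordinal_sum_iff compat_def compat_in_Field)
    show "inj_on (map_sum f id) (Field (ordinal_sum r s))"
      unfolding Field_ordinal_sum using f(2) by (intro inj_onI) (auto dest: inj_onD)
  qed
qed

lemma ordinal_sum_ordIso_cong:
  assumes "a =o ordinal_sum r s" "a' =o ordinal_sum r' s" "r =o r'"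
  shows "a =o a'"
proof -
  have "Well_order (ordinal_sum r s)" "Well_order (ordinal_sum r' s)"
    using assms by (auto simp: ordIso_def)
  then have "ordinal_sum r s =o ordinal_sum r' s"
    using assms(3) unfolding ordIso_iff_ordLeq by (blast intro: ordinal_sum_ordLeq_mono)
  then show ?thesis using assms(1,2) by (meson ordIso_symmetric ordIso_transitive)
qed

text \<open>\<open>r\<close> is the initial segment of \<open>c\<close> below some \<open>b\<close>.
  The finite part is placed on \<open>b\<close> and its iterated successors, which exist in
  \<open>c\<close> because \<open>c\<close> is unbounded.\<close>

lemma ordinal_sum_natLeq_on_ordLeq:
  assumes a: "a =o ordinal_sum r (natLeq_on n)" and less: "r <o c" and c: "unbounded c"
  shows "a \<le>o c"
proof -
  have W: "Well_order c" "Well_order r" using less by (auto simp: ordLess_def)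
  note R = Well_orderD[OF W(1)]
  obtain s where s: "\<And>x. x \<in> Field c \<Longrightarrow> (x, s x) \<in> c - Id"
    using unbounded_successor[OF W(1) c] by metis
  obtain b where b: "b \<in> Field c" "r =o Restr c (underS c b)"
    using less ordLess_iff_ordIso_Restr[OF W] by blast
  then obtain u where u: "compat r (Restr c (underS c b)) u" "inj_on u (Field r)"
    by (meson ordIso_imp_ordLeq ordLeq_compat)
  have uS: "u x \<in> underS c b" if "x \<in> Field r" for x
    using compat_in_Field[OF u(1) that] subsetD[OF Field_Restr_subset] by metis
  have tF: "(s ^^ k) b \<in> Field c" for k
    by (induction k) (use b s in \<open>auto intro: FieldI2\<close>)
  have tstep: "((s ^^ k) b, (s ^^ Suc k) b) \<in> c - Id" for k using s[OF tF] by simp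
  have tmono: "k \<le> l \<Longrightarrow> ((s ^^ k) b, (s ^^ l) b) \<in> c" for k l
  proof (induction l rule: dec_induct)
    case base show ?case using R(2) tF .
  next
    case (step l) then show ?case using tstep[of l] R(4) by blast
  qed
  have tneq: "(s ^^ k) b \<noteq> (s ^^ l) b" if "k < l" for k l
  proof
    assume eq: "(s ^^ k) b = (s ^^ l) b"
    have "((s ^^ Suc k) b, (s ^^ l) b) \<in> c" using that by (intro tmono) simp
    then show False using tstep[of k] R(3) eq by (metis DiffE pair_in_Id_conv)
  qed
  have ut: "(u x, (s ^^ k) b) \<in> c" "u x \<noteq> (s ^^ k) b" if "x \<in> Field r" for x k
    using uS[OF that] tmono[of 0 k] R(3,4) by (auto simp: underS_def)
  let ?f = "case_sum u (\<lambda>k. (s ^^ k) b)"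
  have "ordinal_sum r (natLeq_on n) \<le>o c"
  proof (rule ordLeq_if_compat[OF _ W(1)])
    show "Well_order (ordinal_sum r (natLeq_on n))" using a by (auto simp: ordIso_def)
    show "compat (ordinal_sum r (natLeq_on n)) c ?f"
      using compatD[OF u(1)] ut tmono by (intro compat_ordinal_sumI) auto
    show "inj_on ?f (Field (ordinal_sum r (natLeq_on n)))"
    proof (rule inj_onI)
      fix z w assume zw: "z \<in> Field (ordinal_sum r (natLeq_on n))"
        "w \<in> Field (ordinal_sum r (natLeq_on n))" "?f z = ?f w"
      have "k = l" if "(s ^^ k) b = (s ^^ l) b" for k l using tneq that by (metis nat_neq_iff)
      then show "z = w"
        using zw inj_onD[OF u(2)] ut(2) ut(2)[symmetric]
        by (cases z; cases w) (auto simp: Field_ordinal_sum)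
    qed
  qed
  then show ?thesis using a by (rule ordIso_ordLeq_trans[rotated])
qed

text \<open>Gives an ordinal that is to be absorbed the shape of a sum with empty finite
  part.\<close>

lemma condenses_ordinal_sum_0: "condenses r (ordinal_sum r (natLeq_on 0))"
proof -
  have "bij_betw Inl (Field r) (Field (ordinal_sum r (natLeq_on 0)))"
    unfolding Field_ordinal_sum Field_natLeq_on by (simp add: bij_betw_def)
  moreover have "compat r (ordinal_sum r (natLeq_on 0)) Inl"
    by (simp add: compat_def ordinal_sum_iff)
  ultimately show ?thesis unfolding condenses_def by blast
qed

section \<open>Sequences of ordinals\<close>

text \<open>The index \<open>i\<close> lies in the fibre over \<open>\<phi> i\<close>, and the
  condensation of that fibre can be restricted to the component \<open>i\<close>.\<close>

lemma condensing_ordLeq: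
  assumes W: "\<And>i. i \<in> I \<Longrightarrow> Well_order (r i)" and \<phi>: "condensing I r \<phi>" and i: "i \<in> I"
  shows "r i \<le>o r (\<phi> i)"
proof -
  have \<phi>i: "\<phi> i \<in> I" using \<phi> i by blast
  let ?Q = "disjoint_union {k \<in> I. \<phi> k = \<phi> i} r"
  have "condenses ?Q (r (\<phi> i))" using \<phi> \<phi>i by blast
  then obtain f where f: "inj_on f (Field ?Q)" "compat ?Q (r (\<phi> i)) f"
    by (auto simp: condenses_def bij_betw_def)
  show ?thesis
  proof (rule ordLeq_if_compat[OF W[OF i] W[OF \<phi>i]])
    show "compat (r i) (r (\<phi> i)) (\<lambda>x. f (i, x))" unfolding compat_def
      using i by (intro allI impI compatD[OF f(2)]) (simp add: disjoint_union_iff)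
    show "inj_on (\<lambda>x. f (i, x)) (Field (r i))"
    proof (rule inj_onI)
      fix x y assume "x \<in> Field (r i)" "y \<in> Field (r i)" "f (i, x) = f (i, y)"
      then have "(i, x) = (i, y)" using i by (intro inj_onD[OF f(1)]) (auto simp: Field_disjoint_union)
      then show "x = y" by simp
    qed
  qed
qed

lemma ordinal_fibre_cong: "a =o b \<Longrightarrow> ordinal_fibre I r a = ordinal_fibre I r b"
  unfolding ordinal_fibre_def by (blast intro: ordIso_transitive ordIso_symmetric)

text \<open>By induction along the ordinals, smaller classes are mapped to themselves, so only
  members of a class can be mapped into it. A finite class is then covered by its own image, and
  \<open>\<phi>\<close> permutes it.\<close>

lemma surj_ordLeq_rigid:
  fixes r :: "'i \<Rightarrow> 'a rel"
  assumes W: "\<And>i. i \<in> I \<Longrightarrow> Well_order (r i)"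
    and \<phi>: "\<phi> ` I = I" "\<And>i. i \<in> I \<Longrightarrow> r i \<le>o r (\<phi> i)"
    and D: "D \<subseteq> I" "\<And>i k. i \<in> D \<Longrightarrow> k \<in> I \<Longrightarrow> r k \<le>o r i \<Longrightarrow> k \<in> D"
    and fin: "\<And>i. i \<in> D \<Longrightarrow> finite (ordinal_fibre I r (r i))"
  shows "inj_on \<phi> D" "\<And>i. i \<in> I \<Longrightarrow> \<phi> i \<in> D \<longleftrightarrow> i \<in> D"
proof -
  define S where "S j = ordinal_fibre I r (r j)" for j
  have S: "k \<in> S j \<longleftrightarrow> k \<in> I \<and> r k =o r j" for k j by (simp add: S_def ordinal_fibre_def)
  have S_self: "j \<in> S j" if "j \<in> I" for j using W that by (simp add: S ordIso_reflexive)
  have S_eq: "S k = S j" if "k \<in> S j" for k j 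
    using that ordinal_fibre_cong[of "r k" "r j" I r] by (simp add: S) (simp add: S_def)
  have claim: "j \<in> D \<Longrightarrow> {k \<in> I. \<phi> k \<in> S j} = S j" for j
    using wf_inv_image[OF wf_ordLess, of r]
  proof (induction j)
    case (less j)
    let ?A = "{k \<in> I. \<phi> k \<in> S j}"
    have sub: "?A \<subseteq> S j"
    proof (rule subsetI, rule ccontr)
      \<comment> \<open>Such a \<open>k\<close> has a smaller ordinal, and the induction hypothesis
        keeps \<open>\<phi> k\<close> in the class of \<open>k\<close>.\<close>
      fix k assume "k \<in> ?A" and not: "k \<notin> S j"
      then have k: "k \<in> I" "\<phi> k \<in> S j" by auto
      then have "r (\<phi> k) =o r j" by (simp add: S)
      with \<phi>(2)[OF k(1)] have "r k \<le>o r j" by (rule ordLeq_ordIso_trans)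
      then have "r k <o r j" and kD: "k \<in> D"
        using not k D(2)[OF less.prems] by (auto simp: S ordLeq_iff_ordLess_or_ordIso)
      then have "{l \<in> I. \<phi> l \<in> S k} = S k" using less.IH by (simp add: in_inv_image)
      then have "\<phi> k \<in> S k" using S_self k(1) by blast
      then have "S k = S j" using S_eq k(2) by metis
      then show False using not S_self k(1) by blast
    qed
    have "\<phi> ` ?A = S j"
    proof (intro equalityI subsetI)
      fix l assume l: "l \<in> S j"
      then have "l \<in> \<phi> ` I" using \<phi>(1) by (simp add: S)
      then show "l \<in> \<phi> ` ?A" using l by blast
    qed auto
    moreover have finS: "finite (S j)" using fin less.prems by (simp add: S_def)
    \<comment> \<open>\<open>\<phi>\<close> maps \<open>?A\<close> onto \<open>S j\<close>, so the
      subset \<open>?A\<close> of the finite set \<open>S j\<close> has at least as many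
      elements.\<close>
    ultimately have "card (S j) \<le> card ?A" using sub by (metis card_image_le finite_subset)
    then show ?case using sub finS card_seteq by blast
  qed
  have inj: "inj_on \<phi> (S j)" if j: "j \<in> D" for j
  proof -
    have "\<phi> ` {k \<in> I. \<phi> k \<in> S j} = S j"
    proof (intro equalityI subsetI)
      fix l assume l: "l \<in> S j"
      then have "l \<in> \<phi> ` I" using \<phi>(1) by (simp add: S)
      then show "l \<in> \<phi> ` {k \<in> I. \<phi> k \<in> S j}" using l by blast
    qed auto
    then have "\<phi> ` S j = S j" using claim[OF j] by simp
    then show ?thesis using fin[OF j] by (simp add: S_def finite_surj_inj)
  qed
  have in_S: "\<phi> j \<in> S j" if "j \<in> D" for j using claim[OF that] S_self that D(1) by blast
  show "inj_on \<phi> D"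
  proof (rule inj_onI)
    fix x y assume xy: "x \<in> D" "y \<in> D" "\<phi> x = \<phi> y"
    then have "S x = S y" using S_eq in_S by metis
    then have "x \<in> S y" "y \<in> S y" using S_self xy D(1) by blast+
    then show "x = y" using inj xy by (auto dest: inj_onD)
  qed
  show "\<phi> i \<in> D \<longleftrightarrow> i \<in> D" if i: "i \<in> I" for i
  proof
    assume "\<phi> i \<in> D" then show "i \<in> D" using D(2) i \<phi>(2) by blast
  next
    assume iD: "i \<in> D"
    then have "r (\<phi> i) \<le>o r i" "\<phi> i \<in> I" using in_S by (auto simp: S intro: ordIso_imp_ordLeq)
    then show "\<phi> i \<in> D" using D(2) iD by blast
  qed
qed

lemma finite_to_one_ordIso_iff:
  assumes W: "\<And>i. i \<in> I \<Longrightarrow> Well_order (r i)"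
  shows "finite_to_one (=o) I r \<longleftrightarrow> (\<forall>i\<in>I. finite (ordinal_fibre I r (r i)))"
proof
  assume L: "finite_to_one (=o) I r"
  show "\<forall>i\<in>I. finite (ordinal_fibre I r (r i))"
  proof (rule ballI, rule ccontr)
    fix i assume "infinite (ordinal_fibre I r (r i))"
    moreover have "r k =o r l" if "k \<in> ordinal_fibre I r (r i)" "l \<in> ordinal_fibre I r (r i)" for k l
      using that unfolding ordinal_fibre_def by (blast intro: ordIso_transitive ordIso_symmetric)
    moreover have "ordinal_fibre I r (r i) \<subseteq> I" by (auto simp: ordinal_fibre_def)
    ultimately show False using L unfolding finite_to_one_def by blast
  qed
next
  assume R: "\<forall>i\<in>I. finite (ordinal_fibre I r (r i))"
  show "finite_to_one (=o) I r" unfolding finite_to_one_def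
  proof clarify
    fix J assume J: "J \<subseteq> I" "infinite J" "\<forall>i\<in>J. \<forall>j\<in>J. r i =o r j"
    then obtain i where i: "i \<in> J" by fastforce
    then have "J \<subseteq> ordinal_fibre I r (r i)" using J by (auto simp: ordinal_fibre_def)
    then show False using R J i finite_subset by blast
  qed
qed

text \<open>The predicate \<open>unbounded\<close> covers limit ordinals and 0 together, which
  avoids a case distinction on \<open>\<gamma> i\<close>.\<close>

locale ordinal_sequence =
  fixes I :: "'i set" and \<alpha> \<gamma> :: "'i \<Rightarrow> 'a rel" and n :: "'i \<Rightarrow> nat"
  assumes Well_order_seq: "\<And>i. i \<in> I \<Longrightarrow> Well_order (\<alpha> i)"
    and Well_order_limit: "\<And>i. i \<in> I \<Longrightarrow> Well_order (\<gamma> i)"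
    and unbounded_limit: "\<And>i. i \<in> I \<Longrightarrow> unbounded (\<gamma> i)"
    and seq_ordIso: "\<And>i. i \<in> I \<Longrightarrow> \<alpha> i =o ordinal_sum (\<gamma> i) (natLeq_on (n i))"
begin

section \<open>Limit and finite parts, and condensing onto a single term\<close>

lemma limit_ordLeq_seq: "i \<in> I \<Longrightarrow> \<gamma> i \<le>o \<alpha> i"
  by (rule ordLeq_ordinal_sum[OF seq_ordIso Well_order_limit])

lemma seq_ordLeq_limit: "i \<in> I \<Longrightarrow> j \<in> I \<Longrightarrow> \<gamma> i <o \<gamma> j \<Longrightarrow> \<alpha> i \<le>o \<gamma> j"
  by (rule ordinal_sum_natLeq_on_ordLeq[OF seq_ordIso _ unbounded_limit])

text \<open>When \<open>\<gamma> m\<close> is the maximum of the limit parts, this is the index set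
  \<open>J\<^sub>\<gamma> - I\<^sub>\<gamma>\<close> of condition (II).\<close>

abbreviation (input) tail_indices :: "'i \<Rightarrow> 'i set" where
  "tail_indices m \<equiv> ordinal_fibre I \<gamma> (\<gamma> m) - ordinal_fibre I \<alpha> (\<gamma> m)"

lemma tail_indicesD:
  assumes "k \<in> tail_indices m"
  shows "k \<in> I" "\<gamma> k =o \<gamma> m" "n k > 0"
proof -
  show k: "k \<in> I" "\<gamma> k =o \<gamma> m" using assms by (auto simp: ordinal_fibre_def)
  show "n k > 0"
  proof (rule ccontr)
    assume "\<not> n k > 0"
    then have "\<alpha> k =o ordinal_sum (\<gamma> k) (natLeq_on 0)" using seq_ordIso[OF k(1)] by simp
    then have "\<alpha> k =o \<gamma> k" using Well_order_limit[OF k(1)] by (rule ordIso_ordinal_sum_0)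
    then have "\<alpha> k =o \<gamma> m" using k(2) by (rule ordIso_transitive)
    then show False using assms k(1) by (simp add: ordinal_fibre_def)
  qed
qed

lemma condenses_tail_sum:
  assumes F: "F \<subseteq> tail_indices m" and j: "j \<in> tail_indices m"
    and cond: "condenses (disjoint_union F \<alpha>) (\<alpha> j)"
  shows "finite F \<and> sum n F = n j"
proof (rule condenses_ordinal_sum_natLeq_onD)
  have jI: "j \<in> I" using tail_indicesD(1)[OF j] .
  have FI: "i \<in> I" if "i \<in> F" for i using tail_indicesD(1) F that by blast
  show "Well_order (\<gamma> j)" using Well_order_limit jI .
  show "\<gamma> i =o \<gamma> j" if "i \<in> F" for i
    using tail_indicesD(2)[OF j] tail_indicesD(2)[of i m] F that
    by (blast intro: ordIso_transitive ordIso_symmetric)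
  show "unbounded (\<gamma> i)" if "i \<in> F" for i using unbounded_limit FI that by blast
  show "n i > 0" if "i \<in> F" for i using tail_indicesD(3) F that by blast
  have "condenses (disjoint_union F (\<lambda>i. ordinal_sum (\<gamma> i) (natLeq_on (n i)))) (disjoint_union F \<alpha>)"
    using ordIso_condenses[OF ordIso_symmetric[OF seq_ordIso[OF FI]]] by (rule condenses_disjoint_union)
  moreover have "condenses (\<alpha> j) (ordinal_sum (\<gamma> j) (natLeq_on (n j)))"
    using seq_ordIso[OF jI] by (rule ordIso_condenses)
  ultimately show "condenses (disjoint_union F (\<lambda>i. ordinal_sum (\<gamma> i) (natLeq_on (n i))))
      (ordinal_sum (\<gamma> j) (natLeq_on (n j)))"
    by (rule condenses_trans[OF condenses_trans[OF _ cond]])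
qed

text \<open>Finitely many copies of the limit part condense onto one, and the finite parts are laid
  end to end. Any member of \<open>F\<close> can serve as the copy that takes up the
  remainder.\<close>

lemma condenses_sum_tail:
  assumes F: "F \<subseteq> tail_indices m" "finite F" "F \<noteq> {}" and j: "j \<in> tail_indices m"
    and sum: "sum n F = n j"
  shows "condenses (disjoint_union F \<alpha>) (\<alpha> j)"
proof -
  have jI: "j \<in> I" using tail_indicesD(1)[OF j] .
  have FI: "i \<in> I" if "i \<in> F" for i using tail_indicesD(1) F(1) that by blast
  have iso: "\<gamma> i =o \<gamma> j" if "i \<in> F" for i
    using tail_indicesD(2)[OF j] tail_indicesD(2)[of i m] F(1) that
    by (blast intro: ordIso_transitive ordIso_symmetric)
  obtain i0 where i0: "i0 \<in> F" using F(3) by blast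
  have lim: "condenses (disjoint_union F \<gamma>) (\<gamma> j)"
    using Well_order_limit[OF jI] unbounded_limit[OF jI] F(2) i0 iso
    by (intro condenses_unbounded[of _ _ i0]) (auto intro: ordIso_imp_ordLeq)
  have parts: "condenses (disjoint_union F (\<lambda>i. ordinal_sum (\<gamma> i) (natLeq_on (n i))))
      (ordinal_sum (\<gamma> j) (natLeq_on (n j)))"
    using condenses_ordinal_sum[OF lim condenses_natLeq_on[OF F(2), of n]] by (simp only: sum)
  have "condenses (disjoint_union F \<alpha>)
      (disjoint_union F (\<lambda>i. ordinal_sum (\<gamma> i) (natLeq_on (n i))))"
    using ordIso_condenses[OF seq_ordIso[OF FI]] by (rule condenses_disjoint_union)
  moreover have "condenses (ordinal_sum (\<gamma> j) (natLeq_on (n j))) (\<alpha> j)"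
    by (rule ordIso_condenses[OF ordIso_symmetric[OF seq_ordIso[OF jI]]])
  ultimately show ?thesis by (rule condenses_trans[OF condenses_trans[OF _ parts]])
qed

text \<open>The limit part of \<open>\<alpha> j\<close> swallows all of \<open>\<alpha> i\<close>,
  so the finite part stays \<open>n j\<close>. Accordingly \<open>\<alpha> i\<close> enters as a
  lower part with finite part 0.\<close>

lemma condenses_absorb:
  assumes "i \<in> I" "j \<in> I" "\<alpha> i \<le>o \<gamma> j" "i \<noteq> j"
  shows "condenses (disjoint_union {i, j} \<alpha>) (\<alpha> j)"
proof -
  define r where "r k = (if k = j then \<gamma> j else \<alpha> k)" for k
  define m where "m k = (if k = j then n j else 0)" for k
  have lim: "condenses (disjoint_union {i, j} r) (\<gamma> j)"
    using Well_order_limit[OF assms(2)] unbounded_limit[OF assms(2)] assms(3)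
    by (intro condenses_unbounded[of _ _ j]) (auto simp: r_def ordIso_reflexive ordLeq_reflexive)
  have sum: "sum m {i, j} = n j" using assms(4) by (simp add: m_def)
  have parts: "condenses (disjoint_union {i, j} (\<lambda>k. ordinal_sum (r k) (natLeq_on (m k))))
      (ordinal_sum (\<gamma> j) (natLeq_on (n j)))"
    using condenses_ordinal_sum[OF lim condenses_natLeq_on[of "{i, j}" m]] sum by simp
  have "condenses (disjoint_union {i, j} \<alpha>)
      (disjoint_union {i, j} (\<lambda>k. ordinal_sum (r k) (natLeq_on (m k))))"
  proof (rule condenses_disjoint_union)
    fix k
    show "condenses (\<alpha> k) (ordinal_sum (r k) (natLeq_on (m k)))" if "k \<in> {i, j}"
    proof (cases "k = j")
      case True
      then show ?thesis using ordIso_condenses[OF seq_ordIso[OF assms(2)]] by (simp add: r_def m_def)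
    next
      case False
      then show ?thesis using condenses_ordinal_sum_0[of "\<alpha> k"] by (simp add: r_def m_def)
    qed
  qed
  moreover have "condenses (ordinal_sum (\<gamma> j) (natLeq_on (n j))) (\<alpha> j)"
    by (rule ordIso_condenses[OF ordIso_symmetric[OF seq_ordIso[OF assms(2)]]])
  ultimately show ?thesis by (rule condenses_trans[OF condenses_trans[OF _ parts]])
qed

section \<open>Construction of condensing maps that are not injective\<close>

text \<open>The index \<open>j\<close> absorbs one member of the infinite class of \<open>i\<close>; a bijection between the rest
  of the class and the whole class then makes the map surjective.\<close>

lemma infinite_fibre_absorbed:
  assumes ij: "i \<in> I" "j \<in> I" and inf: "infinite (ordinal_fibre I \<alpha> (\<alpha> i))" and le: "\<alpha> i \<le>o \<gamma> j"
  shows "\<exists>\<phi>. condensing I \<alpha> \<phi> \<and> \<not> inj_on \<phi> I"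
proof -
  \<comment> \<open>The class may contain \<open>j\<close> itself, which has to stay fixed.\<close>
  define S where "S = ordinal_fibre I \<alpha> (\<alpha> i) - {j}"
  have S: "S \<subseteq> I" "j \<notin> S" "\<And>k. k \<in> S \<Longrightarrow> \<alpha> k =o \<alpha> i" by (auto simp: S_def ordinal_fibre_def)
  have infS: "infinite S" using inf by (simp add: S_def)
  then obtain i0 where i0: "i0 \<in> S" by fastforce
  obtain h where h: "bij_betw h S (S - {i0})" using infinite_imp_bij_betw[OF infS] by blast
  then have b: "bij_betw (inv_into S h) (S - {i0}) S" by (rule bij_betw_inv_into)
  let ?b = "inv_into S h"
  \<comment> \<open>\<open>i0\<close> is the member spared for \<open>j\<close>; the inverse of
    \<open>h\<close> spreads the others over all of \<open>S\<close>.\<close>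
  define \<phi> where "\<phi> k = (if k = i0 then j else if k \<in> S then ?b k else k)" for k
  have bS: "?b k \<in> S" if "k \<in> S" "k \<noteq> i0" for k using bij_betwE[OF b] that by blast
  have fib: "{k \<in> I. \<phi> k = j} = {i0, j}"
    using bS S i0 ij by (auto simp: \<phi>_def)
  have fib2: "\<exists>k\<in>S. {l \<in> I. \<phi> l = t} = {k}" if t: "t \<in> S" for t
  proof -
    have "t \<in> ?b ` (S - {i0})" using t bij_betw_imp_surj_on[OF b] by simp
    then obtain k where k: "k \<in> S - {i0}" "?b k = t" by blast
    have "l = k" if "\<phi> l = t" for l
    proof -
      have "l \<in> S - {i0}" "?b l = t" using that t S(2) by (auto simp: \<phi>_def split: if_splits)
      then show ?thesis using k inj_onD[OF bij_betw_imp_inj_on[OF b]] by blast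
    qed
    then have "{l \<in> I. \<phi> l = t} = {k}" using k S(1) by (auto simp: \<phi>_def)
    then show ?thesis using k by blast
  qed
  have fib3: "{l \<in> I. \<phi> l = t} = {t}" if "t \<in> I" "t \<notin> S" "t \<noteq> j" for t
    using that bS i0 by (auto simp: \<phi>_def split: if_splits)
  have cond: "condenses (disjoint_union {k \<in> I. \<phi> k = t} \<alpha>) (\<alpha> t) \<and> {k \<in> I. \<phi> k = t} \<noteq> {}"
    if t: "t \<in> I" for t
  proof -
    consider "t = j" | "t \<in> S" | "t \<notin> S" "t \<noteq> j" by blast
    then show ?thesis
    proof cases
      case 1
      have "\<alpha> i0 \<le>o \<gamma> j" using S(3)[OF i0] le by (rule ordIso_ordLeq_trans)
      then show ?thesis using condenses_absorb[of i0 j] 1 fib i0 S ij by auto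
    next
      case 2
      then obtain k where k: "k \<in> S" "{l \<in> I. \<phi> l = t} = {k}" using fib2 by blast
      have "\<alpha> k =o \<alpha> t" using S(3) k(1) 2 by (blast intro: ordIso_transitive ordIso_symmetric)
      then show ?thesis using k(2) condenses_singleton[OF ordIso_condenses] by simp
    next
      case 3
      have "condenses (\<alpha> t) (\<alpha> t)"
        by (rule ordIso_condenses[OF ordIso_reflexive[OF Well_order_seq[OF t]]])
      then show ?thesis using fib3[OF t 3] condenses_singleton[of \<alpha> t] by simp
    qed
  qed
  have "\<phi> k \<in> I" if "k \<in> I" for k using that bS S(1) ij by (auto simp: \<phi>_def)
  moreover have "t \<in> \<phi> ` I" if "t \<in> I" for t using cond[OF that] by blast
  ultimately have "\<phi> ` I = I" by blast
  moreover have "\<not> inj_on \<phi> I"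
  proof
    have "\<phi> i0 = \<phi> j" "i0 \<in> I" "i0 \<noteq> j" using i0 S by (auto simp: \<phi>_def)
    moreover assume "inj_on \<phi> I"
    ultimately show False using ij by (auto dest: inj_onD)
  qed
  ultimately show ?thesis using cond by blast
qed

text \<open>The witness \<open>f\<close> is extended by the identity. As \<open>f\<close> maps the
  tail indices to themselves, no fibre mixes them with other indices.\<close>

lemma tail_condensing:
  assumes f: "f ` tail_indices m = tail_indices m" "\<not> inj_on f (tail_indices m)"
    and sum: "\<And>j. j \<in> tail_indices m \<Longrightarrow>
      finite {i \<in> tail_indices m. f i = j} \<and> sum n {i \<in> tail_indices m. f i = j} = n j"
  shows "\<exists>\<phi>. condensing I \<alpha> \<phi> \<and> \<not> inj_on \<phi> I"
proof -
  define K where "K = tail_indices m"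
  note f = f[folded K_def]
  have KI: "K \<subseteq> I" by (auto simp: K_def ordinal_fibre_def)
  define \<phi> where "\<phi> k = (if k \<in> K then f k else k)" for k
  have "\<phi> ` I = f ` K \<union> (I - K)" using KI by (auto simp: \<phi>_def)
  then have "\<phi> ` I = I" using f(1) KI by auto
  moreover have "condenses (disjoint_union {i \<in> I. \<phi> i = j} \<alpha>) (\<alpha> j)" if j: "j \<in> I" for j
  proof (cases "j \<in> K")
    case True
    have eq: "{i \<in> I. \<phi> i = j} = {i \<in> K. f i = j}" using KI True by (auto simp: \<phi>_def)
    have "j \<in> f ` K" using f(1) True by simp
    then have "{i \<in> K. f i = j} \<noteq> {}" by blast
    then show ?thesis unfolding eq using sum[of j] True
      by (intro condenses_sum_tail[of _ m]) (auto simp: K_def)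
  next
    case False
    then have eq: "{i \<in> I. \<phi> i = j} = {j}" using f(1) j by (auto simp: \<phi>_def)
    show ?thesis unfolding eq
      by (intro condenses_singleton ordIso_condenses ordIso_reflexive Well_order_seq j)
  qed
  moreover have "\<not> inj_on \<phi> I"
  proof
    assume "inj_on \<phi> I"
    then have "inj_on \<phi> K" using KI by (rule inj_on_subset)
    then show False using f(2) by (simp add: \<phi>_def inj_on_def)
  qed
  ultimately show ?thesis by blast
qed

text \<open>If all condensing maps are injective, no infinite class can be absorbed. An infinite
  class, say that of \<open>m\<close>, then forces every part of (II) except reversibility of the
  numbers; so reversibility fails, and its witness lifts.\<close>

lemma not_inj_condensing:
  assumes "\<not> finite_to_one (=o) I \<alpha>" "\<not> max_condition I \<alpha> \<gamma> n"
  shows "\<exists>\<phi>. condensing I \<alpha> \<phi> \<and> \<not> inj_on \<phi> I"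
proof (rule ccontr)
  assume none: "\<not> ?thesis"
  have noabs: "\<not> \<alpha> k \<le>o \<gamma> j" if "k \<in> I" "j \<in> I" "infinite (ordinal_fibre I \<alpha> (\<alpha> k))" for k j
    using infinite_fibre_absorbed that none by blast
  obtain m where m: "m \<in> I" "infinite (ordinal_fibre I \<alpha> (\<alpha> m))"
    using assms(1) finite_to_one_ordIso_iff Well_order_seq by metis
  have max: "\<gamma> j \<le>o \<gamma> k" if "k \<in> I" "j \<in> I" "infinite (ordinal_fibre I \<alpha> (\<alpha> k))" for j k
  proof (rule ccontr)
    assume "\<not> \<gamma> j \<le>o \<gamma> k"
    \<comment> \<open>A larger limit part \<open>\<gamma> j\<close> would bound
      \<open>\<alpha> k\<close>, whose infinite class could then be absorbed by
      \<open>j\<close>.\<close>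
    then have "\<gamma> k <o \<gamma> j" using Well_order_limit that(1,2) not_ordLeq_iff_ordLess by blast
    then show False using seq_ordLeq_limit noabs that by blast
  qed
  have fin: "finite (ordinal_fibre I \<alpha> a)" if "a \<le>o \<gamma> m" for a :: "'a rel"
  proof (rule ccontr)
    assume inf: "infinite (ordinal_fibre I \<alpha> a)"
    then have "ordinal_fibre I \<alpha> a \<noteq> {}" by auto
    then obtain k where k: "k \<in> I" "\<alpha> k =o a" by (auto simp: ordinal_fibre_def)
    then have "infinite (ordinal_fibre I \<alpha> (\<alpha> k))" using inf ordinal_fibre_cong by metis
    then show False using noabs[OF k(1) m(1)] ordIso_ordLeq_trans[OF k(2) that] by blast
  qed
  have sub: "ordinal_fibre I \<alpha> (\<alpha> m) \<subseteq> tail_indices m"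
  proof
    fix k assume "k \<in> ordinal_fibre I \<alpha> (\<alpha> m)"
    then have k: "k \<in> I" "\<alpha> k =o \<alpha> m" by (auto simp: ordinal_fibre_def)
    then have inf: "infinite (ordinal_fibre I \<alpha> (\<alpha> k))" using m(2) ordinal_fibre_cong by metis
    then have "\<gamma> k =o \<gamma> m" using max k(1) m by (simp add: ordIso_iff_ordLeq)
    moreover have "\<not> \<alpha> k =o \<gamma> m" using noabs[OF k(1) m(1) inf] ordIso_imp_ordLeq by blast
    ultimately show "k \<in> tail_indices m" using k(1) by (simp add: ordinal_fibre_def)
  qed
  have mm: "m \<in> tail_indices m"
    using sub m(1) Well_order_seq by (auto simp: ordinal_fibre_def ordIso_reflexive)
  \<comment> \<open>Isomorphic terms have equal finite parts, by the sum rule for a fibre with one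
    element.\<close>
  have "n k = n m" if k: "k \<in> ordinal_fibre I \<alpha> (\<alpha> m)" for k
  proof -
    have "condenses (disjoint_union {k} \<alpha>) (\<alpha> m)"
      using k by (intro condenses_singleton ordIso_condenses) (simp add: ordinal_fibre_def)
    then show ?thesis using condenses_tail_sum[of "{k}" m m] k sub mm by auto
  qed
  then have "\<not> finite_to_one (=) (tail_indices m) n"
    unfolding finite_to_one_def using sub m(2) by metis
  then have "\<not> reversible_nat_seq (tail_indices m) n"
    using assms(2) m(1) max[OF m(1) _ m(2)] fin unfolding max_condition_def by blast
  then obtain f where "f ` tail_indices m = tail_indices m" "\<not> inj_on f (tail_indices m)"
    "\<forall>j\<in>tail_indices m.
      finite {i \<in> tail_indices m. f i = j} \<and> sum n {i \<in> tail_indices m. f i = j} = n j"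
    unfolding reversible_nat_seq_def using tail_indicesD(3) by blast
  then show False using tail_condensing[of f m] none by blast
qed

section \<open>Injectivity under (I) or (II), and their incompatibility\<close>

lemma finite_to_one_inj:
  assumes "finite_to_one (=o) I \<alpha>" "condensing I \<alpha> \<phi>"
  shows "inj_on \<phi> I"
\<comment> \<open>All classes are finite, so rigidity applies with the whole index set as
  \<open>D\<close>.\<close>
proof (rule surj_ordLeq_rigid(1)[of I \<alpha> \<phi> I, OF Well_order_seq])
  show "\<alpha> i \<le>o \<alpha> (\<phi> i)" if "i \<in> I" for i
    using condensing_ordLeq[OF Well_order_seq assms(2) that] .
  show "finite (ordinal_fibre I \<alpha> (\<alpha> i))" if "i \<in> I" for i
    using assms(1) finite_to_one_ordIso_iff[of I \<alpha>] Well_order_seq that by blast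
qed (use assms(2) in auto)

text \<open>The terms up to \<open>\<gamma> m\<close> form a rigid part \<open>D\<close>, and its
  complement consists of the tail indices. Both are invariant under \<open>\<phi>\<close>; on the
  tail the finite parts add up over fibres, so reversibility of the numbers applies.\<close>

lemma max_condition_inj:
  assumes max: "max_condition I \<alpha> \<gamma> n" and \<phi>: "condensing I \<alpha> \<phi>"
  shows "inj_on \<phi> I"
proof -
  obtain m where m: "m \<in> I" and le: "\<And>i. i \<in> I \<Longrightarrow> \<gamma> i \<le>o \<gamma> m"
    and fin: "\<And>a :: 'a rel. Well_order a \<Longrightarrow> a \<le>o \<gamma> m \<Longrightarrow> finite (ordinal_fibre I \<alpha> a)"
    and rev: "reversible_nat_seq (tail_indices m) n"
    using max by (auto simp: max_condition_def)
  define D where "D = {i \<in> I. \<alpha> i \<le>o \<gamma> m}"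
  \<comment> \<open>If \<open>\<gamma> i\<close> is smaller than \<open>\<gamma> m\<close>, then
    \<open>\<alpha> i\<close> is at most \<open>\<gamma> m\<close>; if they are isomorphic,
    \<open>\<alpha> i\<close> is at most \<open>\<gamma> m\<close> only when isomorphic to
    it.\<close>
  have D_iff: "i \<in> D \<longleftrightarrow> i \<notin> tail_indices m" if i: "i \<in> I" for i
  proof
    assume "i \<in> D"
    then have "\<alpha> i =o \<gamma> m" if "\<gamma> i =o \<gamma> m"
      using limit_ordLeq_seq[OF i] that unfolding D_def
      by (simp add: ordIso_iff_ordLeq) (meson ordLeq_transitive)
    then show "i \<notin> tail_indices m" using i by (auto simp: ordinal_fibre_def)
  next
    assume "i \<notin> tail_indices m"
    then consider "\<alpha> i =o \<gamma> m" | "\<not> \<gamma> i =o \<gamma> m" using i by (auto simp: ordinal_fibre_def)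
    then show "i \<in> D"
    proof cases
      case 1 then show ?thesis using i ordIso_imp_ordLeq by (simp add: D_def)
    next
      case 2
      then have "\<gamma> i <o \<gamma> m" using le[OF i] by (simp add: ordLeq_iff_ordLess_or_ordIso)
      then show ?thesis using seq_ordLeq_limit[OF i m] i by (simp add: D_def)
    qed
  qed
  have KI: "tail_indices m \<subseteq> I" by (auto simp: ordinal_fibre_def)
  have up: "\<alpha> i \<le>o \<alpha> (\<phi> i)" if "i \<in> I" for i
    using condensing_ordLeq[OF Well_order_seq \<phi> that] .
  have D: "D \<subseteq> I" "\<And>i k. i \<in> D \<Longrightarrow> k \<in> I \<Longrightarrow> \<alpha> k \<le>o \<alpha> i \<Longrightarrow> k \<in> D"
    and Dfin: "\<And>i. i \<in> D \<Longrightarrow> finite (ordinal_fibre I \<alpha> (\<alpha> i))"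
    using fin Well_order_seq ordLeq_transitive by (auto simp: D_def)
  have surj: "\<phi> ` I = I" using \<phi> by blast
  have injD: "inj_on \<phi> D" and inv: "\<And>i. i \<in> I \<Longrightarrow> \<phi> i \<in> D \<longleftrightarrow> i \<in> D"
    using surj_ordLeq_rigid[OF Well_order_seq surj up D Dfin] by auto
  have \<phi>K: "\<phi> i \<in> tail_indices m \<longleftrightarrow> i \<in> tail_indices m" if "i \<in> I" for i
    using D_iff inv[OF that] that surj by blast
  have surjK: "\<phi> ` tail_indices m = tail_indices m"
  proof (intro equalityI subsetI)
    fix j assume "j \<in> \<phi> ` tail_indices m"
    then show "j \<in> tail_indices m" using \<phi>K KI by blast
  next
    fix j assume j: "j \<in> tail_indices m"
    then obtain i where "i \<in> I" "j = \<phi> i" using surj KI by blast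
    then show "j \<in> \<phi> ` tail_indices m" using \<phi>K j by blast
  qed
  have "finite {i \<in> tail_indices m. \<phi> i = j} \<and> sum n {i \<in> tail_indices m. \<phi> i = j} = n j"
    if j: "j \<in> tail_indices m" for j
  proof (rule condenses_tail_sum[OF _ j])
    \<comment> \<open>By invariance of the tail indices, the full fibre over \<open>j\<close>
      already lies among them.\<close>
    have "{i \<in> I. \<phi> i = j} = {i \<in> tail_indices m. \<phi> i = j}" using \<phi>K KI j by blast
    moreover have "condenses (disjoint_union {i \<in> I. \<phi> i = j} \<alpha>) (\<alpha> j)" using \<phi> KI j by blast
    ultimately show "condenses (disjoint_union {i \<in> tail_indices m. \<phi> i = j} \<alpha>) (\<alpha> j)" by simp
  qed blast
  then have injK: "inj_on \<phi> (tail_indices m)"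
    using rev surjK unfolding reversible_nat_seq_def by blast
  show ?thesis
  proof (rule inj_onI)
    fix i k assume ik: "i \<in> I" "k \<in> I" "\<phi> i = \<phi> k"
    then have "i \<in> D \<longleftrightarrow> k \<in> D" using inv by metis
    then show "i = k"
      using ik injD injK D_iff unfolding inj_on_def by blast
  qed
qed

text \<open>Tail indices with equal numbers carry isomorphic ordinals, so infinite repetition passes
  from the numbers to the terms. This gives the word "exactly" in the theorem.\<close>

lemma max_condition_not_finite_to_one:
  assumes "max_condition I \<alpha> \<gamma> n" shows "\<not> finite_to_one (=o) I \<alpha>"
proof -
  obtain m J where J: "J \<subseteq> tail_indices m" "infinite J" "\<forall>i\<in>J. \<forall>j\<in>J. n i = n j"
    using assms unfolding max_condition_def finite_to_one_def by blast
  have "\<alpha> i =o \<alpha> j" if "i \<in> J" "j \<in> J" for i j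
  proof (rule ordinal_sum_ordIso_cong)
    have i: "i \<in> I" "\<gamma> i =o \<gamma> m" and j: "j \<in> I" "\<gamma> j =o \<gamma> m"
      using tail_indicesD[of i m] tail_indicesD[of j m] J(1) that by blast+
    show "\<alpha> i =o ordinal_sum (\<gamma> i) (natLeq_on (n i))" using seq_ordIso[OF i(1)] .
    have "n i = n j" using J(3) that by blast
    then show "\<alpha> j =o ordinal_sum (\<gamma> j) (natLeq_on (n i))" using seq_ordIso[OF j(1)] by simp
    show "\<gamma> i =o \<gamma> j" using i(2) ordIso_symmetric[OF j(2)] by (rule ordIso_transitive)
  qed
  moreover have "J \<subseteq> I" using J(1) by (auto simp: ordinal_fibre_def)
  ultimately show ?thesis using J(2) unfolding finite_to_one_def by blast
qed

end

theorem theorem2p1: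
  fixes I :: "'i set" and \<alpha> \<gamma> :: "'i \<Rightarrow> 'a rel" and n :: "'i \<Rightarrow> nat"
  assumes "I \<noteq> {}"
    and "\<And>i. i \<in> I \<Longrightarrow> Well_order (\<alpha> i) \<and> \<alpha> i \<noteq> {}"
    and "\<And>i. i \<in> I \<Longrightarrow> limit_ordinal (\<gamma> i) \<or> \<gamma> i = {}"
    and "\<And>i. i \<in> I \<Longrightarrow> \<alpha> i =o ordinal_sum (\<gamma> i) (natLeq_on (n i))"
  shows "(reversible (disjoint_union I \<alpha>) \<longleftrightarrow>
            (finite_to_one (=o) I \<alpha> \<and> \<not> max_condition I \<alpha> \<gamma> n) \<or>
            (\<not> finite_to_one (=o) I \<alpha> \<and> max_condition I \<alpha> \<gamma> n)) \<and>
         (reversible (disjoint_union I (\<lambda>i. (\<alpha> i)\<inverse>)) \<longleftrightarrow>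
            (finite_to_one (=o) I \<alpha> \<and> \<not> max_condition I \<alpha> \<gamma> n) \<or>
            (\<not> finite_to_one (=o) I \<alpha> \<and> max_condition I \<alpha> \<gamma> n))"
proof -
  interpret ordinal_sequence I \<alpha> \<gamma> n
  proof
    fix i assume i: "i \<in> I"
    show "Well_order (\<alpha> i)" using assms(2)[OF i] by blast
    show "\<alpha> i =o ordinal_sum (\<gamma> i) (natLeq_on (n i))" using assms(4)[OF i] .
    show "Well_order (\<gamma> i)" "unbounded (\<gamma> i)"
      using assms(3)[OF i] by (auto simp: limit_ordinal_def unbounded_def)
  qed
  have "reversible (disjoint_union I \<alpha>) \<longleftrightarrow> (\<forall>\<phi>. condensing I \<alpha> \<phi> \<longrightarrow> inj_on \<phi> I)"
    using assms(2) by (intro reversible_disjoint_union_iff) (auto simp: well_order_on_def)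
  also have "\<dots> \<longleftrightarrow> finite_to_one (=o) I \<alpha> \<or> max_condition I \<alpha> \<gamma> n"
  proof
    assume "\<forall>\<phi>. condensing I \<alpha> \<phi> \<longrightarrow> inj_on \<phi> I"
    then show "finite_to_one (=o) I \<alpha> \<or> max_condition I \<alpha> \<gamma> n"
      using not_inj_condensing by metis
  next
    assume "finite_to_one (=o) I \<alpha> \<or> max_condition I \<alpha> \<gamma> n"
    then show "\<forall>\<phi>. condensing I \<alpha> \<phi> \<longrightarrow> inj_on \<phi> I"
      by (elim disjE) (intro allI impI finite_to_one_inj max_condition_inj; assumption)+
  qed
  also have "\<dots> \<longleftrightarrow> (finite_to_one (=o) I \<alpha> \<and> \<not> max_condition I \<alpha> \<gamma> n) \<or>
      (\<not> finite_to_one (=o) I \<alpha> \<and> max_condition I \<alpha> \<gamma> n)"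
    using max_condition_not_finite_to_one by blast
  \<comment> \<open>The union of the reversed orders is the converse of the union, and reversing an
    order changes neither its homomorphisms nor its automorphisms.\<close>
  finally show ?thesis by (simp add: disjoint_union_converse reversible_converse_iff)
qed

end
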